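(* Let $d\ge1$ and $\mu>-\frac12$. For $n=0,1,2,\ldots$, every $u\in\mathcal V_n^E(\mathbb V^{d+1},W_{\frac12,\mu})$ satisfies $$\Big[\partial_t^2+\Delta_x+\frac2t\langle x,\nabla_x\rangle\partial_t-2\big(t\partial_t+\langle x,\nabla_x\rangle\big)+\frac{2\mu+d}t\partial_t\Big]u=-2n\,u .$$ Furthermore, every $u\in\mathcal V_n^O(\mathbb V^{d+1},W_{-\frac12,\mu})$ satisfies $$\Big[\partial_t^2+\Delta_x+\frac2t\langle x,\nabla_x\rangle\Big(\partial_t-\frac1t\Big)-2\big(t\partial_t+\langle x,\nabla_x\rangle\big)+\frac{2\mu+d-2}t\Big(\partial_t-\frac1t\Big)\Big]u=-2n\,u .$$
   Context: $\mathbb V^{d+1}=\{(x,t)\in\mathbb R^d\times\mathbb R:\ \|x\|\le|t|\}$ is the infinite solid double cone and $W_{\beta,\mu}(x,t)=|t|^{2\beta}e^{-t^2}(t^2-\|x\|^2)^{\mu-\frac12}$. Put $\langle f,g\rangle_W=\int_{\mathbb V^{d+1}}f\,g\,W\,dx\,dt$. $\mathcal V_n^E(\mathbb V^{d+1},W)$ (resp. $\mathcal V_n^O(\mathbb V^{d+1},W)$) is the space of polynomials in $(x,t)$ of degree at most $n$ that are even (resp. odd) in $t$ and orthogonal with respect to $\langle\cdot,\cdot\rangle_W$ to all polynomials of degree at most $n-1$ that are even (resp. odd) in $t$. (For $\beta=-\frac12$ the form is used only on polynomials odd in $t$, where it is finite.) $\Delta_x,\nabla_x$ act on $x\in\mathbb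 R^d$; $\langle x,\nabla_x\rangle=\sum_ix_i\partial_{x_i}$; $\partial_t$ is the derivative in $t$ with $x$ fixed; $(\partial_t-\frac1t)u=\partial_tu-u/t$. The identities hold for $t\ne0$. *)

theory Defs
  imports "HOL-Analysis.Analysis"
begin

text \<open>
  Points of \<open>\<real>\<^sup>d \<times> \<real>\<close> are pairs of type \<open>(real^'d) \<times> real\<close> with \<open>d = CARD('d)\<close>, so \<open>d \<ge> 1\<close>.
\<close>

definition double_cone :: "((real^'d) \<times> real) set"
  where "double_cone = {(x, t). norm x \<le> \<bar>t\<bar>}"

text \<open>
  On the null set where \<open>t = 0\<close> or \<open>norm x = \<bar>t\<bar>\<close>, the convention \<open>0 powr a = 0\<close> makes the
  weight zero; this does not affect any integral.
\<close>

definition cone_weight :: "real \<Rightarrow> real \<Rightarrow> (real^'d) \<times> real \<Rightarrow> real"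
  where "cone_weight \<beta> \<mu> = (\<lambda>(x, t).
    \<bar>t\<bar> powr (2 * \<beta>) * exp (- t\<^sup>2) * (t\<^sup>2 - (norm x)\<^sup>2) powr (\<mu> - 1/2))"

definition cone_inner ::
  "((real^'d) \<times> real \<Rightarrow> real) \<Rightarrow> ((real^'d) \<times> real \<Rightarrow> real) \<Rightarrow> ((real^'d) \<times> real \<Rightarrow> real) \<Rightarrow> real"
  where "cone_inner W f g = (LINT z:double_cone|lborel. f z * g z * W z)"

text \<open>
  Polynomials are identified with the functions they define, which is harmless over the reals;
  the degree is the total degree in \<open>(x, t)\<close>. The index set of the sum is finite.
\<close>

definition poly_deg_le :: "nat \<Rightarrow> ((real^'d) \<times> real \<Rightarrow> real) set"
  where "poly_deg_le n = {p. \<exists>c :: ('d \<Rightarrow> nat) \<Rightarrow> nat \<Rightarrow> real. \<forall>x t.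
    p (x, t) = (\<Sum>(\<alpha>, k) \<in> {(\<alpha>, k). (\<Sum>i\<in>UNIV. \<alpha> i) + k \<le> n}.
      c \<alpha> k * (\<Prod>i\<in>UNIV. x $ i ^ \<alpha> i) * t ^ k)}"

lemma finite_poly_indices:
  "finite {(\<alpha> :: 'd::finite \<Rightarrow> nat, k :: nat). (\<Sum>i\<in>UNIV. \<alpha> i) + k \<le> n}"
proof -
  have "(\<alpha>, k) \<in> (Pi\<^sub>E UNIV (\<lambda>_. {..n})) \<times> {..n}"
    if "(\<Sum>i\<in>UNIV. \<alpha> i) + k \<le> n" for \<alpha> :: "'d \<Rightarrow> nat" and k
  proof -
    have "\<alpha> i \<le> n" for i
      using member_le_sum[of i UNIV \<alpha>] that by simp
    with that show ?thesis by auto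
  qed
  then have "{(\<alpha> :: 'd \<Rightarrow> nat, k :: nat). (\<Sum>i\<in>UNIV. \<alpha> i) + k \<le> n}
      \<subseteq> (Pi\<^sub>E UNIV (\<lambda>_. {..n})) \<times> {..n}"
    by blast
  moreover have "finite ((Pi\<^sub>E (UNIV :: 'd set) (\<lambda>_. {..n})) \<times> {..n})"
    by (intro finite_cartesian_product finite_PiE) auto
  ultimately show ?thesis by (rule finite_subset)
qed

definition even_in_t :: "((real^'d) \<times> real \<Rightarrow> real) \<Rightarrow> bool"
  where "even_in_t f \<longleftrightarrow> (\<forall>x t. f (x, - t) = f (x, t))"

definition odd_in_t :: "((real^'d) \<times> real \<Rightarrow> real) \<Rightarrow> bool"
  where "odd_in_t f \<longleftrightarrow> (\<forall>x t. f (x, - t) = - f (x, t))"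

text \<open>
  Degree at most \<open>n - 1\<close> is written as degree at most \<open>m\<close> for some \<open>m < n\<close>, so that for \<open>n = 0\<close>
  there is no orthogonality condition.
\<close>

definition V_even ::
  "nat \<Rightarrow> ((real^'d) \<times> real \<Rightarrow> real) \<Rightarrow> ((real^'d) \<times> real \<Rightarrow> real) set"
  where "V_even n W = {u \<in> poly_deg_le n. even_in_t u \<and>
    (\<forall>m<n. \<forall>q \<in> poly_deg_le m. even_in_t q \<longrightarrow> cone_inner W u q = 0)}"

definition V_odd ::
  "nat \<Rightarrow> ((real^'d) \<times> real \<Rightarrow> real) \<Rightarrow> ((real^'d) \<times> real \<Rightarrow> real) set"
  where "V_odd n W = {u \<in> poly_deg_le n. odd_in_t u \<and>
    (\<forall>m<n. \<forall>q \<in> poly_deg_le m. odd_in_t q \<longrightarrow> cone_inner W u q = 0)}"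

definition D_t :: "((real^'d) \<times> real \<Rightarrow> real) \<Rightarrow> (real^'d) \<times> real \<Rightarrow> real"
  where "D_t u = (\<lambda>(x, t). deriv (\<lambda>s. u (x, s)) t)"

definition D_x :: "'d \<Rightarrow> ((real^'d) \<times> real \<Rightarrow> real) \<Rightarrow> (real^'d) \<times> real \<Rightarrow> real"
  where "D_x i u = (\<lambda>(x, t). deriv (\<lambda>s. u (x + s *\<^sub>R axis i 1, t)) 0)"

definition Laplace_x :: "((real^'d) \<times> real \<Rightarrow> real) \<Rightarrow> (real^'d) \<times> real \<Rightarrow> real"
  where "Laplace_x u = (\<lambda>z. \<Sum>i\<in>UNIV. D_x i (D_x i u) z)"

text \<open>The operator \<open>\<langle>x, \<nabla>\<^sub>x\<rangle>\<close>.\<close>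

definition Euler_x :: "((real^'d) \<times> real \<Rightarrow> real) \<Rightarrow> (real^'d) \<times> real \<Rightarrow> real"
  where "Euler_x u = (\<lambda>(x, t). \<Sum>i\<in>UNIV. x $ i * D_x i u (x, t))"

text \<open>The operator \<open>\<partial>\<^sub>t - 1/t\<close>, meaningful for \<open>t \<noteq> 0\<close>.\<close>

definition D_t_minus :: "((real^'d) \<times> real \<Rightarrow> real) \<Rightarrow> (real^'d) \<times> real \<Rightarrow> real"
  where "D_t_minus u = (\<lambda>(x, t). D_t u (x, t) - u (x, t) / t)"

end

theory Submission
  imports Defs
begin

text \<open>
  Put \<open>\<sigma> = t\<^sup>2 - (norm x)\<^sup>2\<close>. Since the weight with \<open>\<beta> = 1/2\<close> contains exactly the Jacobian \<open>|t|\<close> of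
  \<open>t \<mapsto> \<sigma>\<close>, it becomes the product \<open>exp (- (norm x)\<^sup>2) * exp (- \<sigma>) * \<sigma>\<^bsup>\<mu> - 1/2\<^esup>\<close> in the coordinates
  \<open>(x, \<sigma>)\<close>, so that the moments of \<open>x\<^sup>\<alpha> \<sigma>\<^sup>j\<close> are products of Gamma values. In these coordinates the
  differential operator \<open>L\<close> is a sum of Hermite operators in the \<open>x\<^sub>i\<close> and a Laguerre operator in
  \<open>\<sigma>\<close>; it is symmetric for the inner product, as the recurrences of the moments show, and acts on
  \<open>x\<^sup>\<alpha> \<sigma>\<^sup>j\<close> as multiplication by \<open>- 2 (|\<alpha>| + 2 j)\<close> up to terms of lower degree. Hence, for \<open>u\<close> in
  \<open>V_even n\<close>, the polynomial \<open>r = L u + 2 n u\<close> has degree less than \<open>n\<close> and satisfies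
  \<open>\<langle>r, r\<rangle> = \<langle>u, L r\<rangle> + 2 n \<langle>u, r\<rangle> = 0\<close>, which forces \<open>r = 0\<close>. An element of \<open>V_odd n\<close> is \<open>t\<close> times an
  element of \<open>V_even (n - 1)\<close>, and multiplication by \<open>t\<close> carries one operator to the other.
\<close>

section \<open>Moments of the weight\<close>

text \<open>The change of variables theorem speaks of absolute integrability over the completed
  Lebesgue measure; for Borel functions the completion changes nothing, and products are formed over
  \<open>lborel\<close>.\<close>

lemma has_bochner_integral_lborel_absolutely_integrable:
  fixes f :: "real \<Rightarrow> real"
  assumes f: "f absolutely_integrable_on S"
    and [measurable]: "S \<in> sets borel" "f \<in> borel_measurable borel"
  shows "has_bochner_integral lborel (\<lambda>x. indicator S x * f x) (integral S f)"
proof -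
  have "set_integrable lborel S f"
    using f unfolding set_integrable_def by (subst (asm) integrable_completion) simp_all
  then show ?thesis
    using set_borel_integral_eq_integral(2)[of S f]
    by (simp add: has_bochner_integral_iff set_integrable_def set_lebesgue_integral_def)
qed

text \<open>Substitution s = t^2 - c^2 in Euler's integral: the factor 2 t is the Jacobian, and exp
  (- t^2) splits as exp (- c^2) exp (- s).\<close>

lemma has_bochner_integral_Gamma_shifted:
  fixes c p :: real
  assumes "0 \<le> c" "0 < p"
  shows "has_bochner_integral lborel
    (\<lambda>t. indicator {c<..} t * (2 * t * exp (- t\<^sup>2) * (t\<^sup>2 - c\<^sup>2) powr (p - 1)))
    (exp (- c\<^sup>2) * Gamma p)"
proof -
  let ?f = "\<lambda>s::real. s powr (p - 1) / exp s" and ?g = "\<lambda>t::real. t\<^sup>2 - c\<^sup>2"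
  have "(?f has_integral Gamma p) {0<..}"
    using Gamma_integral_real[OF assms(2)]
    by (rule has_integral_spike_set_eq[THEN iffD1, rotated -1]) (auto intro: negligible_subset[of "{0}"])
  then have f: "?f absolutely_integrable_on {0<..} \<and> integral {0<..} ?f = Gamma p"
    by (auto intro!: nonnegative_absolutely_integrable_1 simp: has_integral_iff)
  have sq: "c\<^sup>2 < t\<^sup>2" if "c < t" for t
    using that assms by (simp add: power_strict_mono)
  have img: "?g ` {c<..} = {0<..}"
  proof (intro equalityI subsetI)
    fix s :: real assume s: "s \<in> {0<..}"
    then have "c < sqrt (s + c\<^sup>2)" by (simp add: assms real_less_rsqrt)
    moreover have "s = ?g (sqrt (s + c\<^sup>2))" using s by simp
    ultimately show "s \<in> ?g ` {c<..}" by blast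
  qed (use sq in auto)
  have "inj_on ?g {c<..}"
    using assms by (auto simp: inj_on_def power2_eq_iff)
  moreover have "(?g has_field_derivative 2 * t) (at t within {c<..})" for t
    by (auto intro!: derivative_eq_intros)
  ultimately have g: "(\<lambda>t. \<bar>2 * t\<bar> * ?f (?g t)) absolutely_integrable_on {c<..} \<and>
      integral {c<..} (\<lambda>t. \<bar>2 * t\<bar> * ?f (?g t)) = Gamma p"
    using f has_absolute_integral_change_of_variables_1'[of "{c<..}" ?g "\<lambda>t. 2 * t" ?f "Gamma p"]
    by (simp add: img)
  have "has_bochner_integral lborel (\<lambda>t. indicator {c<..} t * (\<bar>2 * t\<bar> * ?f (?g t))) (Gamma p)"
    using has_bochner_integral_lborel_absolutely_integrable[OF conjunct1[OF g]] g by simp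
  then have "has_bochner_integral lborel
      (\<lambda>t. exp (- c\<^sup>2) * (indicator {c<..} t * (\<bar>2 * t\<bar> * ?f (?g t)))) (exp (- c\<^sup>2) * Gamma p)"
    by (rule has_bochner_integral_mult_right)
  moreover have "exp (- c\<^sup>2) * (indicator {c<..} t * (\<bar>2 * t\<bar> * ?f (?g t))) =
      indicator {c<..} t * (2 * t * exp (- t\<^sup>2) * (t\<^sup>2 - c\<^sup>2) powr (p - 1))" for t
    using assms by (auto simp: indicator_def exp_diff exp_minus field_simps)
  ultimately show ?thesis by simp
qed

text \<open>The integrand is even in t, so averaging the one-sided integral with its reflection
  covers both halves of the fibre and turns 2 t into |t|.\<close>

lemma has_bochner_integral_cone_fibre:
  fixes c p :: real
  assumes "0 \<le> c" "0 < p"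
  shows "has_bochner_integral lborel
    (\<lambda>t. indicator {t. c \<le> \<bar>t\<bar>} t * (\<bar>t\<bar> * exp (- t\<^sup>2) * (t\<^sup>2 - c\<^sup>2) powr (p - 1)))
    (exp (- c\<^sup>2) * Gamma p)"
proof -
  define h where "h t = indicator {c<..} t * (2 * t * exp (- t\<^sup>2) * (t\<^sup>2 - c\<^sup>2) powr (p - 1))" for t
  have 1: "has_bochner_integral lborel h (exp (- c\<^sup>2) * Gamma p)"
    unfolding h_def by (rule has_bochner_integral_Gamma_shifted[OF assms])
  then have "has_bochner_integral lborel (\<lambda>t. h (0 + (-1) * t)) ((exp (- c\<^sup>2) * Gamma p) /\<^sub>R \<bar>-1\<bar>)"
    by (subst lborel_has_bochner_integral_real_affine_iff[symmetric]) auto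
  then have "has_bochner_integral lborel (\<lambda>t. (h t + h (- t)) / 2)
      ((exp (- c\<^sup>2) * Gamma p + exp (- c\<^sup>2) * Gamma p) / 2)"
    (is "has_bochner_integral _ _ ?v")
    by (intro has_bochner_integral_divide_zero has_bochner_integral_add 1) simp_all
  \<comment> \<open>The one-sided set is open while the cone is closed; at |t| = c both sides vanish
    because \<open>0 powr a = 0\<close>.\<close>
  moreover have "(h t + h (- t)) / 2 =
      indicator {t. c \<le> \<bar>t\<bar>} t * (\<bar>t\<bar> * exp (- t\<^sup>2) * (t\<^sup>2 - c\<^sup>2) powr (p - 1))" for t
  proof (cases "\<bar>t\<bar> = c")
    case True
    then have "t\<^sup>2 = c\<^sup>2" by auto
    with True assms show ?thesis by (auto simp: h_def indicator_def)
  qed (use assms in \<open>auto simp: h_def indicator_def\<close>)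
  moreover have "?v = exp (- c\<^sup>2) * Gamma p" by simp
  ultimately show ?thesis by (simp only:)
qed

section \<open>Gaussian moments and products over coordinates\<close>

definition gauss_moment :: "nat \<Rightarrow> real"
  where "gauss_moment a = (if even a then Gamma ((real a + 1) / 2) else 0)"

text \<open>With c = 0 and p = (a + 1) / 2 the fibre integral becomes the absolute moment, as |t|
  (t^2) powr (p - 1) is |t|^a. Parity then decides: for even \<open>a\<close> the absolute value
  drops out, for odd \<open>a\<close> reflection gives 0.\<close>

lemma has_bochner_integral_gauss_moment:
  "has_bochner_integral lborel (\<lambda>y::real. y ^ a * exp (- y\<^sup>2)) (gauss_moment a)"
proof -
  have "has_bochner_integral lborel
    (\<lambda>t. indicator {t. 0 \<le> \<bar>t\<bar>} t * (\<bar>t\<bar> * exp (- t\<^sup>2) * (t\<^sup>2 - 0\<^sup>2) powr ((real a + 1) / 2 - 1)))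
    (Gamma ((real a + 1) / 2))"
    using has_bochner_integral_cone_fibre[of 0 "(real a + 1) / 2"] by simp
  \<comment> \<open>The origin is excepted: for \<open>a = 0\<close> the two integrands differ
    there, one being 0 and the other 1.\<close>
  then have abs: "has_bochner_integral lborel (\<lambda>t. \<bar>t ^ a * exp (- t\<^sup>2)\<bar>) (Gamma ((real a + 1) / 2))"
  proof (rule has_bochner_integral_discrete_difference[where X = "{0}", THEN iffD1, rotated 4])
    fix t :: real assume "t \<notin> {0}"
    then have "\<bar>t\<bar> * (t\<^sup>2) powr ((real a + 1) / 2 - 1) = \<bar>t\<bar> ^ a"
    proof -
      have "t\<^sup>2 = \<bar>t\<bar> powr 2" using \<open>t \<notin> {0}\<close> by (simp add: powr_numeral)
      then have "(t\<^sup>2) powr ((real a + 1) / 2 - 1) = \<bar>t\<bar> powr (real a - 1)"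
        by (simp only: powr_powr) (simp add: diff_divide_distrib)
      also have "\<bar>t\<bar> * \<dots> = \<bar>t\<bar> powr real a"
        using \<open>t \<notin> {0}\<close> by (simp add: powr_diff)
      finally show ?thesis using \<open>t \<notin> {0}\<close> by (simp add: powr_realpow)
    qed
    then show "indicator {t. 0 \<le> \<bar>t\<bar>} t * (\<bar>t\<bar> * exp (- t\<^sup>2) * (t\<^sup>2 - 0\<^sup>2) powr ((real a + 1) / 2 - 1))
        = \<bar>t ^ a * exp (- t\<^sup>2)\<bar>"
      by (simp add: abs_mult power_abs algebra_simps)
  qed simp_all
  show ?thesis
  proof (cases "even a")
    case True
    then have "\<bar>t ^ a * exp (- t\<^sup>2)\<bar> = t ^ a * exp (- t\<^sup>2)" for t :: real
      by (simp add: zero_le_even_power)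
    with abs True show ?thesis by (simp add: gauss_moment_def)
  next
    case False
    have int: "integrable lborel (\<lambda>t::real. t ^ a * exp (- t\<^sup>2))"
      using abs by (subst integrable_abs_iff[symmetric]) (auto simp: has_bochner_integral_iff)
    have "(LINT (t::real)|lborel. t ^ a * exp (- t\<^sup>2)) = - (LINT (t::real)|lborel. t ^ a * exp (- t\<^sup>2))"
      using False lborel_integral_real_affine[of "-1" "\<lambda>t. t ^ a * exp (- t\<^sup>2)" 0]
      by simp
    then have "(LINT (t::real)|lborel. t ^ a * exp (- t\<^sup>2)) = 0" by simp
    with int False show ?thesis by (simp add: has_bochner_integral_iff gauss_moment_def)
  qed
qed

text \<open>The functional equation of Gamma at (a + 1) / 2; it takes the place of an integration by
  parts.\<close>

lemma gauss_moment_Suc_Suc: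
  "gauss_moment (a + 2) = (real a + 1) / 2 * gauss_moment a"
  using Gamma_plus1[of "(real a + 1) / 2"]
  by (auto simp: gauss_moment_def add_divide_distrib nonpos_Ints_def)

text \<open>
  The right-hand side is symmetric in \<open>a\<close> and \<open>b\<close>: this is the self-adjointness of the Hermite
  operator \<open>f'' - 2 y f'\<close>. The analogue for \<open>\<sigma>\<close> is \<open>Gamma_operator\<close> below.
\<close>

lemma gauss_moment_operator:
  "real a * real (a - 1) * gauss_moment (a - 2 + b) - 2 * real a * gauss_moment (a + b) =
    - real a * real b * gauss_moment (a + b - 2)"
proof -
  \<comment> \<open>The split isolates the small exponents at which \<open>a - 2\<close> or
    \<open>a + b - 2\<close> is truncated; the coefficients in front are 0 there.\<close>
  consider "a = 0" | "a = 1" "b = 0" | c where "a = 1" "b = Suc c" | c where "a = c + 2"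
    by (metis One_nat_def add_2_eq_Suc' not0_implies_Suc)
  then show ?thesis
  proof cases
    case 2
    then show ?thesis by (simp add: gauss_moment_def)
  next
    case (3 c)
    then show ?thesis using gauss_moment_Suc_Suc[of c] by (simp add: field_simps)
  next
    case (4 c)
    then show ?thesis using gauss_moment_Suc_Suc[of "c + b"] by (simp add: field_simps)
  qed simp
qed

text \<open>\<open>lborel\<close> on \<open>real^'d\<close> is the image of a product measure
  indexed by the standard basis. Once basis vectors are matched with coordinates, the product rule
  for integrals over such a measure applies.\<close>

lemma has_bochner_integral_lborel_prod:
  fixes f :: "'d::finite \<Rightarrow> real \<Rightarrow> real"
  assumes f: "\<And>i. has_bochner_integral lborel (f i) (m i)"
  shows "has_bochner_integral lborel (\<lambda>x::real^'d. \<Prod>i\<in>UNIV. f i (x $ i)) (\<Prod>i\<in>UNIV. m i)"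
proof -
  interpret product_sigma_finite "\<lambda>_::real^'d. lborel :: real measure" by unfold_locales
  \<comment> \<open>\<open>ix\<close> recovers a coordinate from its basis vector.\<close>
  define ix :: "real^'d \<Rightarrow> 'd" where "ix b = (THE i. b = axis i 1)" for b
  have ix: "ix (axis i 1) = i" for i by (auto simp: ix_def axis_eq_axis)
  have bij: "bij_betw (\<lambda>i. axis i (1::real)) (UNIV :: 'd set) Basis"
    by (auto simp: bij_betw_def inj_on_def axis_eq_axis Basis_vec_def)
  have prod_Basis: "(\<Prod>b\<in>Basis. h b) = (\<Prod>i\<in>UNIV. h (axis i 1))" for h :: "real^'d \<Rightarrow> real"
    using prod.reindex_bij_betw[OF bij, of h] by simp
  have int: "integrable lborel (f i)" and m: "m i = integral\<^sup>L lborel (f i)" for i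
    using f[of i] by (auto simp: has_bochner_integral_iff)
  have [measurable]: "f i \<in> borel_measurable borel" for i
    using borel_measurable_integrable[OF int[of i]] by simp
  let ?\<phi> = "\<lambda>g. \<Sum>b\<in>Basis. g b *\<^sub>R b :: real^'d"
  let ?P = "\<lambda>x::real^'d. \<Prod>i\<in>UNIV. f i (x $ i)"
  have comp: "?P (?\<phi> g) = (\<Prod>b\<in>Basis. f (ix b) (g b))" for g
  proof -
    have "?\<phi> g $ i = g (axis i 1)" for i
      using inner_sum_left_Basis[of "axis i 1" g] by (simp add: inner_axis axis_in_Basis_iff)
    then show ?thesis by (simp add: prod_Basis ix)
  qed
  have "integrable lborel ?P \<and> integral\<^sup>L lborel ?P = (\<Prod>i\<in>UNIV. m i)"
    unfolding lborel_eq[where 'a = "real^'d"]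
  proof (intro conjI, goal_cases)
    case 1
    then show ?case
      by (subst integrable_distr_eq, measurable) (unfold comp, rule product_integrable_prod, auto simp: int)
  next
    case 2
    then show ?case
      by (subst integral_distr, measurable)
        (unfold comp, subst product_integral_prod, auto simp: int prod_Basis ix m)
  qed
  then show ?thesis by (simp add: has_bochner_integral_iff)
qed


text \<open>
  The even polynomials are the polynomials in \<open>x\<close> and \<open>\<sigma> = t\<^sup>2 - (norm x)\<^sup>2\<close>; \<open>(\<alpha>, j)\<close> stands for
  \<open>x\<^sup>\<alpha> \<sigma>\<^sup>j\<close>, of degree \<open>|\<alpha>| + 2 * j\<close>.
\<close>

definition cone_monomial :: "('d \<Rightarrow> nat) \<times> nat \<Rightarrow> (real^'d) \<times> real \<Rightarrow> real"
  where "cone_monomial p = (\<lambda>(x, t).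
    (\<Prod>i\<in>UNIV. x $ i ^ fst p i) * (t\<^sup>2 - (norm x)\<^sup>2) ^ snd p)"

lemma cone_monomial_mult:
  "cone_monomial p z * cone_monomial q z = cone_monomial (\<lambda>i. fst p i + fst q i, snd p + snd q) z"
  by (simp add: cone_monomial_def power_add prod.distrib split: prod.split)

text \<open>Fubini with the t-integral inside: sigma^j only raises the exponent in the weight, so
  the fibre over x gives exp (- |x|^2) Gamma (mu + 1/2 + j), and the remaining integral factors into
  Gaussian moments.\<close>

lemma has_bochner_integral_cone_monomial:
  fixes p :: "('d::finite \<Rightarrow> nat) \<times> nat"
  assumes "\<mu> > - 1/2"
  shows "has_bochner_integral lborel
    (\<lambda>z. indicator double_cone z * (cone_monomial p z * cone_weight (1/2) \<mu> z))
    (Gamma (\<mu> + 1/2 + real (snd p)) * (\<Prod>i\<in>UNIV. gauss_moment (fst p i)))"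
proof -
  obtain \<alpha> j where p: "p = (\<alpha>, j)" by (cases p)
  define q where "q = \<mu> + 1/2 + real j"
  have q: "q > 0" using assms by (simp add: q_def)
  let ?m = "\<lambda>x::real^'d. \<Prod>i\<in>UNIV. x $ i ^ \<alpha> i"
  define g where "g c t = indicator {t. c \<le> \<bar>t\<bar>} t * (\<bar>t\<bar> * exp (- t\<^sup>2) * (t\<^sup>2 - c\<^sup>2) powr (q - 1))"
    for c t :: real
  define f where "f = (\<lambda>(x::real^'d, t::real).
    indicator double_cone (x, t) * (cone_monomial p (x, t) * cone_weight (1/2) \<mu> (x, t)))"
  have f_eq: "f (x, t) = ?m x * g (norm x) t" for x t
  proof -
    \<comment> \<open>The boundary s = 0 is included: \<open>0 powr a = 0\<close> makes both sides
      0, also for \<open>j = 0\<close>.\<close>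
    have "s ^ j * s powr (\<mu> - 1/2) = s powr (q - 1)" if "0 \<le> s" for s :: real
    proof (cases "s = 0")
      case False
      with that have "s ^ j = s powr real j" by (simp add: powr_realpow)
      then show ?thesis by (simp add: powr_add[symmetric] q_def algebra_simps)
    qed simp
    moreover have "0 \<le> t\<^sup>2 - (norm x)\<^sup>2" if "norm x \<le> \<bar>t\<bar>"
      using that by (simp add: abs_le_square_iff[symmetric])
    ultimately show ?thesis
      by (auto simp: f_def g_def p cone_monomial_def cone_weight_def double_cone_def indicator_def)
  qed
  have [measurable]: "f \<in> borel_measurable (lborel \<Otimes>\<^sub>M lborel)"
  proof -
    have "f = (\<lambda>z. (\<Prod>i\<in>UNIV. fst z $ i ^ \<alpha> i) * ((if norm (fst z) \<le> \<bar>snd z\<bar> then 1 else 0) *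
        (\<bar>snd z\<bar> * exp (- (snd z)\<^sup>2) * ((snd z)\<^sup>2 - (norm (fst z))\<^sup>2) powr (q - 1))))"
      by (auto simp: fun_eq_iff f_eq g_def)
    also have "\<dots> \<in> borel_measurable (lborel \<Otimes>\<^sub>M lborel)"
      unfolding cart_eq_inner_axis by measurable
    finally show ?thesis .
  qed
  have g: "has_bochner_integral lborel (g c) (exp (- c\<^sup>2) * Gamma q)" if "0 \<le> c" for c
    unfolding g_def by (rule has_bochner_integral_cone_fibre[OF that q])
  have fx: "has_bochner_integral lborel (\<lambda>t. f (x, t)) (?m x * (exp (- (norm x)\<^sup>2) * Gamma q))" for x
    unfolding f_eq by (intro has_bochner_integral_mult_right g) simp
  \<comment> \<open>Fubini asks for the integral of the norm; only the monomial in x can be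
    negative, so the absolute value falls on it alone.\<close>
  have fx_norm: "has_bochner_integral lborel (\<lambda>t. norm (f (x, t)))
      \<bar>?m x * (exp (- (norm x)\<^sup>2) * Gamma q)\<bar>" for x
  proof -
    have "norm (f (x, t)) = \<bar>?m x\<bar> * g (norm x) t" for t
      by (simp add: f_eq abs_mult g_def)
    moreover have "\<bar>?m x * (exp (- (norm x)\<^sup>2) * Gamma q)\<bar> = \<bar>?m x\<bar> * (exp (- (norm x)\<^sup>2) * Gamma q)"
      using q by (simp add: abs_mult Gamma_real_pos less_imp_le)
    ultimately show ?thesis
      by (simp only:) (intro has_bochner_integral_mult_right g, simp)
  qed
  have "has_bochner_integral lborel (\<lambda>x::real^'d. \<Prod>i\<in>UNIV. x $ i ^ \<alpha> i * exp (- (x $ i)\<^sup>2))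
      (\<Prod>i\<in>UNIV. gauss_moment (\<alpha> i))"
    by (intro has_bochner_integral_lborel_prod has_bochner_integral_gauss_moment)
  moreover have "(\<Prod>i\<in>UNIV. x $ i ^ \<alpha> i * exp (- (x $ i)\<^sup>2)) = ?m x * exp (- (norm x)\<^sup>2)" for x :: "real^'d"
    by (simp add: prod.distrib exp_sum[symmetric] sum_negf norm_vec_def L2_set_def sum_nonneg)
  ultimately have "has_bochner_integral lborel (\<lambda>x. Gamma q * (?m x * exp (- (norm x)\<^sup>2)))
      (Gamma q * (\<Prod>i\<in>UNIV. gauss_moment (\<alpha> i)))"
    by (intro has_bochner_integral_mult_right) simp
  then have outer: "has_bochner_integral lborel (\<lambda>x. ?m x * (exp (- (norm x)\<^sup>2) * Gamma q))
      (Gamma q * (\<Prod>i\<in>UNIV. gauss_moment (\<alpha> i)))"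
    by (simp only: mult_ac)
  have "integrable (lborel \<Otimes>\<^sub>M lborel) f"
  proof (rule lborel_pair.Fubini_integrable)
    show "integrable lborel (\<lambda>x. LINT t|lborel. norm (f (x, t)))"
      using outer fx_norm by (auto simp: has_bochner_integral_iff)
    show "AE x in lborel. integrable lborel (\<lambda>t. f (x, t))"
      using fx by (auto simp: has_bochner_integral_iff)
  qed simp
  moreover from this have "integral\<^sup>L (lborel \<Otimes>\<^sub>M lborel) f = Gamma q * (\<Prod>i\<in>UNIV. gauss_moment (\<alpha> i))"
    using outer fx by (subst lborel_pair.integral_fst'[symmetric]) (auto simp: has_bochner_integral_iff)
  moreover have "f = (\<lambda>z. indicator double_cone z * (cone_monomial p z * cone_weight (1/2) \<mu> z))"
    by (simp add: f_def fun_eq_iff)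
  ultimately show ?thesis
    by (simp add: has_bochner_integral_iff lborel_prod q_def p)
qed

section \<open>Even polynomials\<close>

lemma norm_sq_sum: "(norm x)\<^sup>2 = (\<Sum>i\<in>UNIV. (x $ i)\<^sup>2)" for x :: "real^'d"
  by (simp add: norm_vec_def L2_set_def sum_nonneg)

text \<open>Kept generic in the family \<open>b\<close> because it serves two bases,
  \<open>cone_monomial\<close> and \<open>xt_monomial\<close>.\<close>

definition lincomb :: "('i \<Rightarrow> 'a \<Rightarrow> real) \<Rightarrow> 'i set \<Rightarrow> ('a \<Rightarrow> real) \<Rightarrow> bool"
  where "lincomb b S f \<longleftrightarrow> (\<exists>c. f = (\<lambda>z. \<Sum>p\<in>S. c p * b p z))"

lemma lincomb_base:
  assumes "finite S" "p \<in> S"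
  shows "lincomb b S (b p)"
proof -
  have "b p = (\<lambda>z. \<Sum>q\<in>S. (if q = p then 1 else 0) * b q z)"
    using assms by (simp add: fun_eq_iff if_distrib[of "\<lambda>r. r * _"] cong: if_cong)
  then show ?thesis
    unfolding lincomb_def by (intro exI)
qed

lemma lincomb_zero: "lincomb b S (\<lambda>_. 0)"
  unfolding lincomb_def by (rule exI[of _ "\<lambda>_. 0"]) simp

lemma lincomb_add: "lincomb b S f \<Longrightarrow> lincomb b S g \<Longrightarrow> lincomb b S (\<lambda>z. f z + g z)"
  unfolding lincomb_def
proof (elim exE)
  fix c d assume "f = (\<lambda>z. \<Sum>p\<in>S. c p * b p z)" "g = (\<lambda>z. \<Sum>p\<in>S. d p * b p z)"
  then have "(\<lambda>z. f z + g z) = (\<lambda>z. \<Sum>p\<in>S. (c p + d p) * b p z)"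
    by (simp add: distrib_right sum.distrib)
  then show "\<exists>c. (\<lambda>z. f z + g z) = (\<lambda>z. \<Sum>p\<in>S. c p * b p z)"
    by (rule exI[of _ "\<lambda>p. c p + d p"])
qed

lemma lincomb_cmult: "lincomb b S f \<Longrightarrow> lincomb b S (\<lambda>z. r * f z)"
  unfolding lincomb_def
proof (elim exE)
  fix c assume "f = (\<lambda>z. \<Sum>p\<in>S. c p * b p z)"
  then have "(\<lambda>z. r * f z) = (\<lambda>z. \<Sum>p\<in>S. (r * c p) * b p z)"
    by (simp add: sum_distrib_left mult_ac)
  then show "\<exists>c. (\<lambda>z. r * f z) = (\<lambda>z. \<Sum>p\<in>S. c p * b p z)"
    by (rule exI[of _ "\<lambda>p. r * c p"])
qed

lemma lincomb_diff: "lincomb b S f \<Longrightarrow> lincomb b S g \<Longrightarrow> lincomb b S (\<lambda>z. f z - g z)"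
  using lincomb_add[of b S f "\<lambda>z. (-1) * g z"] lincomb_cmult[of b S g "-1"] by simp

lemma lincomb_sum:
  assumes "\<And>i. i \<in> I \<Longrightarrow> lincomb b S (f i)"
  shows "lincomb b S (\<lambda>z. \<Sum>i\<in>I. f i z)"
  using assms by (induction I rule: infinite_finite_induct) (auto intro: lincomb_zero lincomb_add)

lemma lincomb_trans:
  assumes "lincomb b S f" "\<And>p. p \<in> S \<Longrightarrow> lincomb b' T (b p)"
  shows "lincomb b' T f"
proof -
  from assms(1) obtain c where "f = (\<lambda>z. \<Sum>p\<in>S. c p * b p z)"
    unfolding lincomb_def by blast
  then show ?thesis
    by (simp add: lincomb_sum lincomb_cmult assms(2))
qed

text \<open>Multiplication by a fixed function \<open>h\<close> is linear, so it suffices to check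
  the basis.\<close>

lemma lincomb_trans_linear:
  assumes "lincomb b S f" "\<And>p. p \<in> S \<Longrightarrow> lincomb b' T (\<lambda>z. h z * b p z)"
  shows "lincomb b' T (\<lambda>z. h z * f z)"
proof -
  from assms(1) obtain c where "f = (\<lambda>z. \<Sum>p\<in>S. c p * b p z)"
    unfolding lincomb_def by blast
  then have "(\<lambda>z. h z * f z) = (\<lambda>z. \<Sum>p\<in>S. c p * (h z * b p z))"
    by (simp add: sum_distrib_left mult_ac)
  then show ?thesis
    by (simp add: lincomb_sum lincomb_cmult assms(2))
qed

definition cone_deg :: "('d::finite \<Rightarrow> nat) \<times> nat \<Rightarrow> nat"
  where "cone_deg p = (\<Sum>i\<in>UNIV. fst p i) + 2 * snd p"

definition cone_poly :: "nat \<Rightarrow> ((real^'d) \<times> real \<Rightarrow> real) \<Rightarrow> bool"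
  where "cone_poly n = lincomb cone_monomial {p. cone_deg p \<le> n}"

lemma finite_cone_deg: "finite {p :: ('d::finite \<Rightarrow> nat) \<times> nat. cone_deg p \<le> n}"
  by (rule finite_subset[OF _ finite_poly_indices[of n]]) (auto simp: cone_deg_def)

lemma cone_poly_monomial: "cone_deg p \<le> n \<Longrightarrow> cone_poly n (cone_monomial p)"
  unfolding cone_poly_def by (rule lincomb_base[OF finite_cone_deg]) simp

lemma cone_poly_mono: "cone_poly m f \<Longrightarrow> m \<le> n \<Longrightarrow> cone_poly n f"
  unfolding cone_poly_def[of m]
  by (subst cone_poly_def, rule lincomb_trans, assumption)
     (fold cone_poly_def, rule cone_poly_monomial, simp)

lemmas cone_poly_add = lincomb_add[where b = cone_monomial and S = "{p. cone_deg p \<le> n}" for n, folded cone_poly_def]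
lemmas cone_poly_cmult = lincomb_cmult[where b = cone_monomial and S = "{p. cone_deg p \<le> n}" for n, folded cone_poly_def]
lemmas cone_poly_sum = lincomb_sum[where b = cone_monomial and S = "{p. cone_deg p \<le> n}" for n, folded cone_poly_def]

lemma cone_poly_zero: "cone_poly n (\<lambda>_. 0)"
  by (simp add: cone_poly_def lincomb_zero)

lemma sum_fun_upd:
  "(\<Sum>i\<in>UNIV. (f(k := a)) i) + f k = (\<Sum>i\<in>UNIV. f i) + a" for f :: "'d::finite \<Rightarrow> nat"
  by (simp add: sum.remove[of UNIV k] add_ac)

lemma prod_power_fun_upd:
  "(\<Prod>i\<in>UNIV. x $ i ^ (f(k := f k + a)) i) = x $ k ^ a * (\<Prod>i\<in>UNIV. x $ i ^ f i)"
  for x :: "real^'d"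
  by (simp add: prod.remove[of UNIV k] power_add mult_ac)

lemma cone_monomial_upd:
  "cone_monomial (\<alpha>(k := \<alpha> k + a), j) (x, t) = x $ k ^ a * cone_monomial (\<alpha>, j) (x, t)"
  unfolding cone_monomial_def by (simp only: prod_power_fun_upd fst_conv snd_conv case_prod_conv mult.assoc)

text \<open>In the new variable t^2 is sigma plus the sum of the x_i^2, and multiplying by any of
  these raises the degree by 2.\<close>

lemma cone_poly_t_squared:
  assumes "cone_poly n f"
  shows "cone_poly (n + 2) (\<lambda>z. (snd z)\<^sup>2 * f z)"
  using assms unfolding cone_poly_def[of n]
proof (subst cone_poly_def, rule lincomb_trans_linear, fold cone_poly_def)
  fix p :: "('d::finite \<Rightarrow> nat) \<times> nat" assume p: "p \<in> {p. cone_deg p \<le> n}"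
  obtain \<alpha> j where [simp]: "p = (\<alpha>, j)" by (cases p)
  have "(snd z)\<^sup>2 * cone_monomial p z =
      cone_monomial (\<alpha>, Suc j) z + (\<Sum>i\<in>UNIV. cone_monomial (\<alpha>(i := \<alpha> i + 2), j) z)" for z
  proof (cases z)
    case [simp]: (Pair x t)
    have "(\<Sum>i\<in>UNIV. cone_monomial (\<alpha>(i := \<alpha> i + 2), j) z) = (norm x)\<^sup>2 * cone_monomial (\<alpha>, j) z"
      by (simp only: Pair cone_monomial_upd norm_sq_sum sum_distrib_right)
    then show ?thesis
      by (simp add: cone_monomial_def algebra_simps)
  qed
  moreover have "cone_deg (\<alpha>(i := \<alpha> i + 2), j) \<le> n + 2" for i
    using p sum_fun_upd[of \<alpha> i "\<alpha> i + 2"] by (simp add: cone_deg_def)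
  ultimately show "cone_poly (n + 2) (\<lambda>z. (snd z)\<^sup>2 * cone_monomial p z)"
    using p by (simp only:) (intro cone_poly_add cone_poly_sum cone_poly_monomial, simp_all add: cone_deg_def)
qed

lemma cone_poly_x_t_power:
  "(\<Sum>i\<in>UNIV. \<alpha> i) + 2 * j \<le> n \<Longrightarrow> cone_poly n (\<lambda>(x, t). (\<Prod>i\<in>UNIV. x $ i ^ \<alpha> i) * t ^ (2 * j))"
proof (induction j arbitrary: n)
  case 0
  then show ?case
    using cone_poly_monomial[of "(\<alpha>, 0)" n] by (simp add: cone_deg_def cone_monomial_def)
next
  case (Suc j)
  then obtain m where n: "n = m + 2" and m: "(\<Sum>i\<in>UNIV. \<alpha> i) + 2 * j \<le> m"
    by (metis add.assoc add_le_cancel_right le_Suc_ex mult_Suc_right add.commute add_leD2 le_add_diff_inverse2)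
  show ?case
    using cone_poly_t_squared[OF Suc.IH[OF m]]
    by (simp add: n case_prod_unfold power2_eq_square mult_ac)
qed

section \<open>Passing between monomials in x, t and monomials in x, sigma\<close>

definition xt_monomial :: "('d \<Rightarrow> nat) \<times> nat \<Rightarrow> (real^'d) \<times> real \<Rightarrow> real"
  where "xt_monomial p = (\<lambda>(x, t). (\<Prod>i\<in>UNIV. x $ i ^ fst p i) * t ^ snd p)"

lemma poly_deg_le_lincomb:
  "poly_deg_le n = {f. lincomb xt_monomial {(\<alpha>, k). (\<Sum>i\<in>UNIV. \<alpha> i) + k \<le> n} f}"
proof (intro equalityI subsetI)
  fix f :: "(real^'d) \<times> real \<Rightarrow> real"
  let ?S = "{(\<alpha> :: 'd \<Rightarrow> nat, k). (\<Sum>i\<in>UNIV. \<alpha> i) + k \<le> n}"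
  assume "f \<in> poly_deg_le n"
  then obtain c where c: "\<And>x t. f (x, t) = (\<Sum>(\<alpha>, k)\<in>?S. c \<alpha> k * (\<Prod>i\<in>UNIV. x $ i ^ \<alpha> i) * t ^ k)"
    unfolding poly_deg_le_def by blast
  have "f = (\<lambda>z. \<Sum>p\<in>?S. case_prod c p * xt_monomial p z)"
    by (auto simp: fun_eq_iff c xt_monomial_def case_prod_unfold mult.assoc)
  then show "f \<in> {f. lincomb xt_monomial ?S f}"
    unfolding lincomb_def by blast
next
  fix f :: "(real^'d) \<times> real \<Rightarrow> real"
  let ?S = "{(\<alpha> :: 'd \<Rightarrow> nat, k). (\<Sum>i\<in>UNIV. \<alpha> i) + k \<le> n}"
  assume "f \<in> {f. lincomb xt_monomial ?S f}"
  then obtain c where c: "f = (\<lambda>z. \<Sum>p\<in>?S. c p * xt_monomial p z)"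
    unfolding lincomb_def by blast
  show "f \<in> poly_deg_le n"
    unfolding poly_deg_le_def
    by (intro CollectI exI[of _ "\<lambda>\<alpha> k. c (\<alpha>, k)"])
      (simp add: c xt_monomial_def case_prod_unfold mult.assoc)
qed

text \<open>Averaging over t and -t kills the monomials odd in t and keeps the even ones, whatever
  coefficients represent \<open>u\<close>. An even polynomial is its own average.\<close>

lemma cone_poly_even_part:
  fixes u :: "(real^'d) \<times> real \<Rightarrow> real"
  assumes "u \<in> poly_deg_le n"
  shows "cone_poly n (\<lambda>(x, t). (u (x, t) + u (x, - t)) / 2)"
proof -
  let ?S = "{(\<alpha> :: 'd \<Rightarrow> nat, k). (\<Sum>i\<in>UNIV. \<alpha> i) + k \<le> n}"
  from assms obtain c where c: "u = (\<lambda>z. \<Sum>p\<in>?S. c p * xt_monomial p z)"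
    by (auto simp: poly_deg_le_lincomb lincomb_def)
  define e where "e p = (\<lambda>(x, t). (xt_monomial p (x, t) + xt_monomial p (x, - t)) / 2)"
    for p :: "('d \<Rightarrow> nat) \<times> nat"
  have "cone_poly n (e p)" if "p \<in> ?S" for p
  proof -
    obtain \<alpha> k where p: "p = (\<alpha>, k)" by (cases p)
    show ?thesis
    proof (cases "even k")
      case True
      then obtain j where k: "k = 2 * j" by blast
      have "e p = (\<lambda>(x, t). (\<Prod>i\<in>UNIV. x $ i ^ \<alpha> i) * t ^ (2 * j))"
        by (auto simp: e_def xt_monomial_def p k)
      with that p k show ?thesis by (simp only:) (rule cone_poly_x_t_power, simp)
    next
      case False
      then have "e p = (\<lambda>_. 0)" by (auto simp: e_def xt_monomial_def p)
      then show ?thesis by (simp only: cone_poly_def lincomb_zero)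
    qed
  qed
  then have "cone_poly n (\<lambda>z. \<Sum>p\<in>?S. c p * e p z)"
    by (intro cone_poly_sum cone_poly_cmult)
  moreover have "(\<lambda>z. \<Sum>p\<in>?S. c p * e p z) = (\<lambda>(x, t). (u (x, t) + u (x, - t)) / 2)"
    by (auto simp: c e_def fun_eq_iff sum.distrib[symmetric] sum_divide_distrib distrib_left intro!: sum.cong)
  ultimately show ?thesis by simp
qed

lemma cone_poly_even:
  fixes u :: "(real^'d) \<times> real \<Rightarrow> real"
  assumes "u \<in> poly_deg_le n" "even_in_t u"
  shows "cone_poly n u"
proof -
  have "(\<lambda>(x, t). (u (x, t) + u (x, - t)) / 2) = u"
    using assms(2) by (auto simp: even_in_t_def)
  with cone_poly_even_part[OF assms(1)] show ?thesis by simp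
qed

text \<open>Antisymmetrising leaves only odd powers of t, and one factor t is split off from each.
  The clause for \<open>n = 0\<close> is there because the truncated degree \<open>n - 1\<close>
  would still admit a nonzero constant \<open>v\<close>.\<close>

lemma cone_poly_odd:
  fixes u :: "(real^'d) \<times> real \<Rightarrow> real"
  assumes "u \<in> poly_deg_le n" "odd_in_t u"
  shows "\<exists>v. cone_poly (n - 1) v \<and> (n = 0 \<longrightarrow> v = (\<lambda>_. 0)) \<and> u = (\<lambda>(x, t). t * v (x, t))"
proof -
  let ?S = "{(\<alpha> :: 'd \<Rightarrow> nat, k). (\<Sum>i\<in>UNIV. \<alpha> i) + k \<le> n}"
  from assms obtain c where c: "u = (\<lambda>z. \<Sum>p\<in>?S. c p * xt_monomial p z)"
    by (auto simp: poly_deg_le_lincomb lincomb_def)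
  define e where "e p = (\<lambda>(x, t). if odd (snd p) then xt_monomial (fst p, snd p - 1) (x, t) else 0)"
    for p :: "('d \<Rightarrow> nat) \<times> nat"
  define v where "v = (\<lambda>z. \<Sum>p\<in>?S. c p * e p z)"
  have e: "cone_poly (n - 1) (e p)" if "p \<in> ?S" for p
  proof -
    obtain \<alpha> k where p: "p = (\<alpha>, k)" by (cases p)
    show ?thesis
    proof (cases "odd k")
      case True
      then obtain j where k: "k = Suc (2 * j)" by (metis oddE Suc_eq_plus1)
      have "e p = (\<lambda>(x, t). (\<Prod>i\<in>UNIV. x $ i ^ \<alpha> i) * t ^ (2 * j))"
        by (auto simp: e_def xt_monomial_def p k)
      with that p k show ?thesis by (simp only:) (rule cone_poly_x_t_power, simp)
    next
      case False
      then have "e p = (\<lambda>_. 0)" by (auto simp: e_def p)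
      then show ?thesis by (simp only: cone_poly_def lincomb_zero)
    qed
  qed
  have "cone_poly (n - 1) v"
    unfolding v_def by (intro cone_poly_sum cone_poly_cmult e)
  moreover have "v = (\<lambda>_. 0)" if "n = 0"
    unfolding v_def using that by (auto simp: e_def intro!: sum.neutral)
  moreover have "u (x, t) = t * v (x, t)" for x t
  proof -
    have "u (x, t) = (u (x, t) - u (x, - t)) / 2"
      using assms(2) by (simp add: odd_in_t_def)
    also have "\<dots> = (\<Sum>p\<in>?S. c p * ((xt_monomial p (x, t) - xt_monomial p (x, - t)) / 2))"
      by (simp add: c sum_subtractf[symmetric] sum_divide_distrib right_diff_distrib)
    also have "\<dots> = (\<Sum>p\<in>?S. c p * (t * e p (x, t)))"
    proof (intro sum.cong refl arg_cong2[of _ _ _ _ "(*)"])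
      fix p :: "('d \<Rightarrow> nat) \<times> nat"
      show "(xt_monomial p (x, t) - xt_monomial p (x, - t)) / 2 = t * e p (x, t)"
        by (cases p; cases "snd p") (auto simp: xt_monomial_def e_def)
    qed
    also have "\<dots> = t * v (x, t)"
      by (simp add: v_def sum_distrib_left mult_ac)
    finally show ?thesis .
  qed
  ultimately show ?thesis
    by (intro exI[of _ v]) auto
qed

text \<open>The induction step for expanding powers of sigma back into x and t.\<close>

lemma poly_deg_le_mult_quadratic:
  fixes f :: "(real^'d) \<times> real \<Rightarrow> real"
  assumes "f \<in> poly_deg_le n"
  shows "(\<lambda>(x, t). (t\<^sup>2 - (norm x)\<^sup>2) * f (x, t)) \<in> poly_deg_le (n + 2)"
proof -
  let ?S = "\<lambda>n. {(\<alpha> :: 'd \<Rightarrow> nat, k). (\<Sum>i\<in>UNIV. \<alpha> i) + k \<le> n}"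
  have "lincomb xt_monomial (?S (n + 2)) (\<lambda>z. ((snd z)\<^sup>2 - (norm (fst z))\<^sup>2) * f z)"
  proof (rule lincomb_trans_linear)
    show "lincomb xt_monomial (?S n) f"
      using assms by (simp add: poly_deg_le_lincomb)
  next
    fix p assume p: "p \<in> ?S n"
    obtain \<alpha> k where [simp]: "p = (\<alpha>, k)" by (cases p)
    have "((snd z)\<^sup>2 - (norm (fst z))\<^sup>2) * xt_monomial p z =
        xt_monomial (\<alpha>, k + 2) z - (\<Sum>i\<in>UNIV. xt_monomial (\<alpha>(i := \<alpha> i + 2), k) z)" for z
    proof (cases z)
      case [simp]: (Pair x t)
      have "(\<Sum>i\<in>UNIV. xt_monomial (\<alpha>(i := \<alpha> i + 2), k) z) = (norm x)\<^sup>2 * xt_monomial (\<alpha>, k) z"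
        by (simp only: Pair xt_monomial_def fst_conv snd_conv case_prod_conv prod_power_fun_upd
            norm_sq_sum sum_distrib_right mult.assoc)
      then show ?thesis
        by (simp add: xt_monomial_def algebra_simps power2_eq_square)
    qed
    moreover have "(\<alpha>(i := \<alpha> i + 2), k) \<in> ?S (n + 2)" for i
      using p sum_fun_upd[of \<alpha> i "\<alpha> i + 2"] by simp
    moreover have "(\<alpha>, k + 2) \<in> ?S (n + 2)"
      using p by simp
    ultimately show "lincomb xt_monomial (?S (n + 2)) (\<lambda>z. ((snd z)\<^sup>2 - (norm (fst z))\<^sup>2) * xt_monomial p z)"
      by (simp only:) (intro lincomb_diff lincomb_sum lincomb_base finite_poly_indices; simp only:)
  qed
  then show ?thesis
    by (simp add: poly_deg_le_lincomb case_prod_unfold)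
qed

text \<open>Turns even test polynomials into odd ones, against which members of \<open>V_odd\<close>
  are orthogonal.\<close>

lemma poly_deg_le_mult_t:
  fixes f :: "(real^'d) \<times> real \<Rightarrow> real"
  assumes "f \<in> poly_deg_le n"
  shows "(\<lambda>(x, t). t * f (x, t)) \<in> poly_deg_le (n + 1)"
proof -
  let ?S = "\<lambda>n. {(\<alpha> :: 'd \<Rightarrow> nat, k). (\<Sum>i\<in>UNIV. \<alpha> i) + k \<le> n}"
  have "lincomb xt_monomial (?S (n + 1)) (\<lambda>z. snd z * f z)"
  proof (rule lincomb_trans_linear)
    show "lincomb xt_monomial (?S n) f"
      using assms by (simp add: poly_deg_le_lincomb)
  next
    fix p assume "p \<in> ?S n"
    moreover have "(\<lambda>z. snd z * xt_monomial p z) = xt_monomial (fst p, snd p + 1)"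
      by (simp add: xt_monomial_def fun_eq_iff mult_ac)
    ultimately show "lincomb xt_monomial (?S (n + 1)) (\<lambda>z. snd z * xt_monomial p z)"
      by (auto intro!: lincomb_base finite_poly_indices)
  qed
  then show ?thesis
    by (simp add: poly_deg_le_lincomb case_prod_unfold)
qed

lemma cone_monomial_poly_deg_le: "cone_deg p \<le> n \<Longrightarrow> cone_monomial p \<in> poly_deg_le n"
proof (induction "snd p" arbitrary: p n)
  case 0
  obtain \<alpha> where p: "p = (\<alpha>, 0)" using 0 by (cases p) simp
  have "cone_monomial p = xt_monomial p"
    by (simp add: p cone_monomial_def xt_monomial_def)
  also have "\<dots> \<in> poly_deg_le n"
    unfolding poly_deg_le_lincomb using 0
    by (intro CollectI lincomb_base finite_poly_indices) (simp add: p cone_deg_def)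
  finally show ?case .
next
  case (Suc j)
  obtain \<alpha> where p: "p = (\<alpha>, Suc j)" using Suc(2) by (cases p) simp
  from Suc.prems have n: "n = (n - 2) + 2" and "cone_deg (\<alpha>, j) \<le> n - 2"
    by (auto simp: p cone_deg_def)
  then have "cone_monomial (\<alpha>, j) \<in> poly_deg_le (n - 2)"
    using Suc.hyps(1)[of "(\<alpha>, j)"] by simp
  from poly_deg_le_mult_quadratic[OF this] show ?case
    by (subst n) (simp add: p cone_monomial_def mult_ac)
qed

text \<open>Orthogonality in \<open>V_even\<close> is stated for \<open>poly_deg_le\<close>, so
  polynomials built from x and sigma are brought back to that form before it applies.\<close>

lemma cone_poly_poly_deg_le:
  assumes "cone_poly n f"
  shows "f \<in> poly_deg_le n"
  using assms unfolding cone_poly_def poly_deg_le_lincomb mem_Collect_eq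
  by (rule lincomb_trans) (use cone_monomial_poly_deg_le in \<open>auto simp: poly_deg_le_lincomb\<close>)

lemma cone_poly_even_in_t:
  assumes "cone_poly n f"
  shows "even_in_t f"
proof -
  from assms obtain c where "f = (\<lambda>z. \<Sum>p\<in>{p. cone_deg p \<le> n}. c p * cone_monomial p z)"
    by (auto simp: cone_poly_def lincomb_def)
  then show ?thesis by (simp add: even_in_t_def cone_monomial_def)
qed

section \<open>The differential operator\<close>

lemma norm_add_axis_sq:
  "(norm (x + s *\<^sub>R axis k 1))\<^sup>2 = (norm x)\<^sup>2 + 2 * s * x $ k + s\<^sup>2" for x :: "real^'d"
  unfolding power2_norm_eq_inner
  by (simp add: inner_add_left inner_add_right inner_axis inner_axis' power2_eq_square algebra_simps)

text \<open>Isolates the dependence on the increment \<open>s\<close>, leaving an explicit function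
  of one real variable for the derivative rules.\<close>

lemma cone_monomial_add_axis:
  "cone_monomial (\<alpha>, j) (x + s *\<^sub>R axis k 1, t) =
    (\<Prod>i\<in>UNIV - {k}. x $ i ^ \<alpha> i) * (x $ k + s) ^ \<alpha> k *
    (t\<^sup>2 - (norm x)\<^sup>2 - 2 * s * x $ k - s\<^sup>2) ^ j"
proof -
  have "(\<Prod>i\<in>UNIV. (x + s *\<^sub>R axis k 1) $ i ^ \<alpha> i) =
      (x $ k + s) ^ \<alpha> k * (\<Prod>i\<in>UNIV - {k}. (x + s *\<^sub>R axis k 1) $ i ^ \<alpha> i)"
    by (simp add: prod.remove[of UNIV k])
  also have "(\<Prod>i\<in>UNIV - {k}. (x + s *\<^sub>R axis k 1) $ i ^ \<alpha> i) = (\<Prod>i\<in>UNIV - {k}. x $ i ^ \<alpha> i)"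
    by (intro prod.cong refl) (simp add: axis_def)
  finally show ?thesis
    unfolding cone_monomial_def by (simp only: norm_add_axis_sq case_prod_conv fst_conv snd_conv)
      (simp add: algebra_simps)
qed

lemma cone_monomial_split:
  "cone_monomial (\<alpha>, j) (x, t) =
    (\<Prod>i\<in>UNIV - {k}. x $ i ^ \<alpha> i) * x $ k ^ \<alpha> k * (t\<^sup>2 - (norm x)\<^sup>2) ^ j"
  using cone_monomial_add_axis[of \<alpha> j x 0 k t] by simp

text \<open>The chain rule with d sigma / dt = 2 t, expressed through \<open>cone_monomial\<close>
  again so that a second differentiation can reuse the first.\<close>

definition cone_monomial_t :: "('d::finite \<Rightarrow> nat) \<times> nat \<Rightarrow> (real^'d) \<times> real \<Rightarrow> real"
  where "cone_monomial_t p = (\<lambda>(x, t). 2 * real (snd p) * t * cone_monomial (fst p, snd p - 1) (x, t))"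

text \<open>The product rule: x_k occurs in its own power and, with d sigma / dx_k = - 2 x_k, in the
  power of sigma.\<close>

definition cone_monomial_x :: "'d::finite \<Rightarrow> ('d \<Rightarrow> nat) \<times> nat \<Rightarrow> (real^'d) \<times> real \<Rightarrow> real"
  where "cone_monomial_x k p = (\<lambda>z.
    real (fst p k) * cone_monomial ((fst p)(k := fst p k - 1), snd p) z -
    2 * real (snd p) * cone_monomial ((fst p)(k := fst p k + 1), snd p - 1) z)"

lemma DERIV_cone_monomial_t:
  "((\<lambda>s. cone_monomial p (x, s)) has_field_derivative cone_monomial_t p (x, t)) (at t)"
  unfolding cone_monomial_t_def cone_monomial_def
  by (auto intro!: derivative_eq_intros)

lemma DERIV_cone_monomial_x:
  "((\<lambda>s. cone_monomial p (x + s *\<^sub>R axis k 1, t)) has_field_derivative cone_monomial_x k p (x, t)) (at 0)"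
proof -
  obtain \<alpha> j where p: "p = (\<alpha>, j)" by (cases p)
  have 1: "cone_monomial (\<alpha>(k := a), i) (x, t) =
      (\<Prod>i\<in>UNIV - {k}. x $ i ^ \<alpha> i) * x $ k ^ a * (t\<^sup>2 - (norm x)\<^sup>2) ^ i" for a i
    by (simp add: cone_monomial_split[where k = k])
  show ?thesis
    unfolding p cone_monomial_add_axis cone_monomial_x_def fst_conv snd_conv 1
    by (auto intro!: derivative_eq_intros simp: algebra_simps)
qed

lemma DERIV_cone_monomial_t_t:
  "((\<lambda>s. cone_monomial_t p (x, s)) has_field_derivative
    2 * real (snd p) * (cone_monomial (fst p, snd p - 1) (x, t)
      + t * cone_monomial_t (fst p, snd p - 1) (x, t))) (at t)"
  unfolding cone_monomial_t_def[of p] case_prod_conv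
  by (auto intro!: derivative_eq_intros DERIV_cone_monomial_t simp: algebra_simps)

lemma DERIV_cone_monomial_t_x:
  "((\<lambda>s. cone_monomial_t p (x + s *\<^sub>R axis k 1, t)) has_field_derivative
    2 * real (snd p) * t * cone_monomial_x k (fst p, snd p - 1) (x, t)) (at 0)"
  unfolding cone_monomial_t_def[of p] case_prod_conv
  by (auto intro!: derivative_eq_intros DERIV_cone_monomial_x simp: algebra_simps)

lemma DERIV_cone_monomial_x_x:
  "((\<lambda>s. cone_monomial_x k p (x + s *\<^sub>R axis k 1, t)) has_field_derivative
    real (fst p k) * cone_monomial_x k ((fst p)(k := fst p k - 1), snd p) (x, t) -
    2 * real (snd p) * cone_monomial_x k ((fst p)(k := fst p k + 1), snd p - 1) (x, t)) (at 0)"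
  unfolding cone_monomial_x_def[of k p]
  by (auto intro!: derivative_eq_intros DERIV_cone_monomial_x)

lemma x_times_cone_monomial_x:
  "x $ k * cone_monomial_x k (\<alpha>, j) (x, t) =
    real (\<alpha> k) * cone_monomial (\<alpha>, j) (x, t)
    - 2 * real j * (x $ k)\<^sup>2 * cone_monomial (\<alpha>, j - 1) (x, t)"
proof -
  have "real (\<alpha> k) * (x $ k * cone_monomial (\<alpha>(k := \<alpha> k - 1), j) (x, t)) =
      real (\<alpha> k) * cone_monomial (\<alpha>, j) (x, t)"
    by (cases "\<alpha> k") (simp_all add: cone_monomial_split[where k = k])
  moreover have "cone_monomial (\<alpha>(k := \<alpha> k + 1), j - 1) (x, t) = x $ k * cone_monomial (\<alpha>, j - 1) (x, t)"
    by (subst cone_monomial_upd) simp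
  ultimately show ?thesis
    by (simp add: cone_monomial_x_def algebra_simps power2_eq_square)
qed

text \<open>
  \<open>cone_op\<close> is the image of \<open>cone_monomial\<close> under the differential operator. Truncated subtraction in
  the exponents is harmless because the corresponding coefficients vanish.
\<close>

definition cone_op :: "real \<Rightarrow> ('d::finite \<Rightarrow> nat) \<times> nat \<Rightarrow> (real^'d) \<times> real \<Rightarrow> real"
  where "cone_op \<mu> p = (\<lambda>z.
    (\<Sum>i\<in>UNIV. real (fst p i) * real (fst p i - 1) * cone_monomial ((fst p)(i := fst p i - 2), snd p) z)
    + 2 * real (snd p) * (2 * real (snd p) - 1 + 2 * \<mu>) * cone_monomial (fst p, snd p - 1) z
    - 2 * real (cone_deg p) * cone_monomial p z)"

text \<open>The middle coefficient collects two mixed contributions: \<open>\<alpha> k\<close> when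
  the power of x_k is differentiated first, \<open>\<alpha> k + 1\<close> when sigma is.\<close>

lemma cone_monomial_x_x_expand:
  "real (\<alpha> k) * cone_monomial_x k (\<alpha>(k := \<alpha> k - 1), j) (x, t) -
    2 * real j * cone_monomial_x k (\<alpha>(k := \<alpha> k + 1), j - 1) (x, t) =
   real (\<alpha> k) * real (\<alpha> k - 1) * cone_monomial (\<alpha>(k := \<alpha> k - 2), j) (x, t)
   - 2 * real j * (2 * real (\<alpha> k) + 1) * cone_monomial (\<alpha>, j - 1) (x, t)
   + 4 * real j * real (j - 1) * (x $ k)\<^sup>2 * cone_monomial (\<alpha>, j - 2) (x, t)"
proof -
  have "real (\<alpha> k) * cone_monomial (\<alpha>(k := \<alpha> k - 1 + 1), j - 1) (x, t) =
      real (\<alpha> k) * cone_monomial (\<alpha>, j - 1) (x, t)"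
    by (cases "\<alpha> k") (simp_all add: fun_upd_idem)
  moreover have "cone_monomial (\<alpha>(k := \<alpha> k + 2), j - 2) (x, t) = (x $ k)\<^sup>2 * cone_monomial (\<alpha>, j - 2) (x, t)"
    by (subst cone_monomial_upd) simp
  ultimately show ?thesis
    by (cases "\<alpha> k") (simp_all add: cone_monomial_x_def fun_upd_idem diff_diff_left numeral_2_eq_2 algebra_simps)
qed

text \<open>The mixed term cancels the part of the Laplacian proportional to |alpha|, and the
  dimension in the last coefficient cancels the other first-order part. In what remains t^2 and
  |x|^2 occur only as t^2 - |x|^2 = sigma, which restores one power of sigma.\<close>

lemma cone_op_pointwise:
  fixes x :: "real^'d"
  assumes t: "t \<noteq> 0"
  shows "2 * real j * (cone_monomial (\<alpha>, j - 1) (x, t) + t * cone_monomial_t (\<alpha>, j - 1) (x, t))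
    + (\<Sum>i\<in>UNIV. real (\<alpha> i) * cone_monomial_x i (\<alpha>(i := \<alpha> i - 1), j) (x, t) -
        2 * real j * cone_monomial_x i (\<alpha>(i := \<alpha> i + 1), j - 1) (x, t))
    + 2 / t * (\<Sum>i\<in>UNIV. x $ i * (2 * real j * t * cone_monomial_x i (\<alpha>, j - 1) (x, t)))
    - 2 * (t * cone_monomial_t (\<alpha>, j) (x, t) + (\<Sum>i\<in>UNIV. x $ i * cone_monomial_x i (\<alpha>, j) (x, t)))
    + (2 * \<mu> + real CARD('d)) / t * cone_monomial_t (\<alpha>, j) (x, t)
    = cone_op \<mu> (\<alpha>, j) (x, t)"
proof -
  let ?N = "(norm x)\<^sup>2" and ?a = "real (\<Sum>i\<in>UNIV. \<alpha> i)"
  let ?c = "\<lambda>j. cone_monomial (\<alpha>, j) (x, t)"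
  define A where "A = (\<Sum>i\<in>UNIV. real (\<alpha> i) * real (\<alpha> i - 1) * cone_monomial (\<alpha>(i := \<alpha> i - 2), j) (x, t))"
  have euler: "(\<Sum>i\<in>UNIV. x $ i * cone_monomial_x i (\<alpha>, l) (x, t)) = ?a * ?c l - 2 * real l * ?N * ?c (l - 1)" for l
    by (simp add: x_times_cone_monomial_x sum_subtractf sum_distrib_left sum_distrib_right norm_sq_sum)
  have laplace: "(\<Sum>i\<in>UNIV. real (\<alpha> i) * cone_monomial_x i (\<alpha>(i := \<alpha> i - 1), j) (x, t) -
        2 * real j * cone_monomial_x i (\<alpha>(i := \<alpha> i + 1), j - 1) (x, t)) =
      A - 2 * real j * (2 * ?a + real CARD('d)) * ?c (j - 1) + 4 * real j * real (j - 1) * ?N * ?c (j - 2)"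
    unfolding cone_monomial_x_x_expand
    by (simp add: A_def sum.distrib sum_subtractf sum_distrib_left sum_distrib_right norm_sq_sum algebra_simps)
  have mixed: "2 / t * (\<Sum>i\<in>UNIV. x $ i * (2 * real j * t * cone_monomial_x i (\<alpha>, j - 1) (x, t))) =
      4 * real j * (?a * ?c (j - 1) - 2 * real (j - 1) * ?N * ?c (j - 2))"
  proof -
    have "(\<Sum>i\<in>UNIV. x $ i * (2 * real j * t * cone_monomial_x i (\<alpha>, j - 1) (x, t))) =
        2 * real j * t * (\<Sum>i\<in>UNIV. x $ i * cone_monomial_x i (\<alpha>, j - 1) (x, t))"
      by (simp add: sum_distrib_left mult_ac)
    then show ?thesis using t by (simp add: euler diff_diff_left numeral_2_eq_2)
  qed
  \<comment> \<open>Here and in \<open>c2\<close>, t^2 is replaced by sigma + |x|^2; the factors in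
    front vanish exactly where the exponent is truncated.\<close>
  have c1: "real j * (t\<^sup>2 * ?c (j - 1)) = real j * (?c j + ?N * ?c (j - 1))"
    by (cases j) (simp_all add: cone_monomial_def algebra_simps)
  have c2: "real j * real (j - 1) * (t\<^sup>2 * ?c (j - 2)) = real j * real (j - 1) * (?c (j - 1) + ?N * ?c (j - 2))"
    by (cases j; cases "j - 1") (simp_all add: cone_monomial_def algebra_simps)
  have rj: "real j * real (j - 1) = real j * (real j - 1)"
    by (cases j) simp_all
  have tt: "2 * real j * (?c (j - 1) + t * cone_monomial_t (\<alpha>, j - 1) (x, t)) =
      2 * real j * ?c (j - 1) + 4 * (real j * real (j - 1) * (t\<^sup>2 * ?c (j - 2)))"
    by (simp add: cone_monomial_t_def power2_eq_square algebra_simps diff_diff_left numeral_2_eq_2)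
  have td: "t * cone_monomial_t (\<alpha>, j) (x, t) = 2 * (real j * (t\<^sup>2 * ?c (j - 1)))"
    by (simp add: cone_monomial_t_def power2_eq_square)
  have dt: "(2 * \<mu> + real CARD('d)) / t * cone_monomial_t (\<alpha>, j) (x, t) =
      (2 * \<mu> + real CARD('d)) * (2 * real j * ?c (j - 1))"
    using t by (simp add: cone_monomial_t_def)
  have op: "cone_op \<mu> (\<alpha>, j) (x, t) = A + 2 * real j * (2 * real j - 1 + 2 * \<mu>) * ?c (j - 1)
      - 2 * (?a + 2 * real j) * ?c j"
    by (simp add: cone_op_def A_def cone_deg_def)
  have e: "(4 * (real j * real (j - 1)) + 2 * real j) * ?c (j - 1) = 2 * real j * (2 * real j - 1) * ?c (j - 1)"
    unfolding rj by (simp add: algebra_simps)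
  show ?thesis
    unfolding tt laplace mixed td dt op euler[of j] c1 c2 using e by (simp add: algebra_simps)
qed

section \<open>Termwise differentiation of polynomials\<close>

lemma D_t_eq: "((\<lambda>s. f (x, s)) has_field_derivative d) (at t) \<Longrightarrow> D_t f (x, t) = d"
  by (simp add: D_t_def DERIV_imp_deriv)

lemma D_x_eq: "((\<lambda>s. f (x + s *\<^sub>R axis i 1, t)) has_field_derivative d) (at 0) \<Longrightarrow> D_x i f (x, t) = d"
  by (simp add: D_x_def DERIV_imp_deriv)

lemma DERIV_weighted_sum:
  fixes c :: "'a \<Rightarrow> real"
  assumes "\<And>p. p \<in> S \<Longrightarrow> (f p has_field_derivative f' p) (at t)"
  shows "((\<lambda>s. \<Sum>p\<in>S. c p * f p s) has_field_derivative (\<Sum>p\<in>S. c p * f' p)) (at t)"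
  using assms by (intro DERIV_sum DERIV_cmult) auto

context
  fixes c :: "('d::finite \<Rightarrow> nat) \<times> nat \<Rightarrow> real" and S and u :: "(real^'d) \<times> real \<Rightarrow> real"
  assumes u: "u = (\<lambda>z. \<Sum>p\<in>S. c p * cone_monomial p z)"
begin

lemma cone_sum_D_t: "D_t u = (\<lambda>z. \<Sum>p\<in>S. c p * cone_monomial_t p z)"
  unfolding u by (auto simp: fun_eq_iff intro!: D_t_eq DERIV_weighted_sum DERIV_cone_monomial_t)

lemma cone_sum_D_x: "D_x i u = (\<lambda>z. \<Sum>p\<in>S. c p * cone_monomial_x i p z)"
  unfolding u by (auto simp: fun_eq_iff intro!: D_x_eq DERIV_weighted_sum DERIV_cone_monomial_x)

text \<open>\<open>deriv\<close> is informative only where a derivative exists; these facts license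
  the product rule when t v is differentiated in the odd case.\<close>

lemma cone_sum_differentiable:
  shows "(\<lambda>s. u (x, s)) field_differentiable at t"
    and "(\<lambda>s. D_t u (x, s)) field_differentiable at t"
    and "(\<lambda>s. u (x + s *\<^sub>R axis i 1, t)) field_differentiable at 0"
    and "(\<lambda>s. D_t u (x + s *\<^sub>R axis i 1, t)) field_differentiable at 0"
    and "(\<lambda>s. D_x i u (x + s *\<^sub>R axis i 1, t)) field_differentiable at 0"
  unfolding cone_sum_D_t cone_sum_D_x unfolding u field_differentiable_def
  by (rule exI, rule DERIV_weighted_sum,
      rule DERIV_cone_monomial_t DERIV_cone_monomial_t_t DERIV_cone_monomial_x
        DERIV_cone_monomial_t_x DERIV_cone_monomial_x_x)+

lemma cone_sum_operator:
  assumes t: "t \<noteq> 0"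
  shows "D_t (D_t u) (x, t) + Laplace_x u (x, t) + 2 / t * Euler_x (D_t u) (x, t)
      - 2 * (t * D_t u (x, t) + Euler_x u (x, t)) + (2 * \<mu> + real CARD('d)) / t * D_t u (x, t)
    = (\<Sum>p\<in>S. c p * cone_op \<mu> p (x, t))"
proof -
  have 1: "D_t (D_t u) (x, t) = (\<Sum>p\<in>S. c p * (2 * real (snd p) * (cone_monomial (fst p, snd p - 1) (x, t)
      + t * cone_monomial_t (fst p, snd p - 1) (x, t))))"
    unfolding cone_sum_D_t by (intro D_t_eq DERIV_weighted_sum DERIV_cone_monomial_t_t)
  have "D_x i (D_x i u) (x, t) = (\<Sum>p\<in>S. c p * (real (fst p i) * cone_monomial_x i ((fst p)(i := fst p i - 1), snd p) (x, t) -
    2 * real (snd p) * cone_monomial_x i ((fst p)(i := fst p i + 1), snd p - 1) (x, t)))" for i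
    unfolding cone_sum_D_x by (intro D_x_eq DERIV_weighted_sum DERIV_cone_monomial_x_x)
  then have 2: "Laplace_x u (x, t) = (\<Sum>p\<in>S. c p * (\<Sum>i\<in>UNIV.
      real (fst p i) * cone_monomial_x i ((fst p)(i := fst p i - 1), snd p) (x, t) -
      2 * real (snd p) * cone_monomial_x i ((fst p)(i := fst p i + 1), snd p - 1) (x, t)))"
    unfolding Laplace_x_def sum_distrib_left by (subst sum.swap) simp
  have "D_x i (D_t u) (x, t) = (\<Sum>p\<in>S. c p * (2 * real (snd p) * t * cone_monomial_x i (fst p, snd p - 1) (x, t)))" for i
    unfolding cone_sum_D_t by (intro D_x_eq DERIV_weighted_sum DERIV_cone_monomial_t_x)
  then have 3: "Euler_x (D_t u) (x, t) = (\<Sum>p\<in>S. c p * (\<Sum>i\<in>UNIV. x $ i *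
      (2 * real (snd p) * t * cone_monomial_x i (fst p, snd p - 1) (x, t))))"
    unfolding Euler_x_def sum_distrib_left by (subst sum.swap) (simp add: sum_distrib_left mult_ac)
  have 4: "Euler_x u (x, t) = (\<Sum>p\<in>S. c p * (\<Sum>i\<in>UNIV. x $ i * cone_monomial_x i p (x, t)))"
    unfolding Euler_x_def cone_sum_D_x case_prod_conv sum_distrib_left
    by (subst sum.swap) (simp add: mult_ac)
  have 5: "D_t u (x, t) = (\<Sum>p\<in>S. c p * cone_monomial_t p (x, t))"
    by (simp add: cone_sum_D_t)
  \<comment> \<open>Gathers the separate sums into one, so that the identity for a single monomial
    applies to each summand.\<close>
  have *: "(\<Sum>p\<in>S. c p * a p) + (\<Sum>p\<in>S. c p * b p) + r * (\<Sum>p\<in>S. c p * d p)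
      - 2 * (t * (\<Sum>p\<in>S. c p * e p) + (\<Sum>p\<in>S. c p * f p)) + s * (\<Sum>p\<in>S. c p * e p) =
      (\<Sum>p\<in>S. c p * (a p + b p + r * d p - 2 * (t * e p + f p) + s * e p))" for a b d e f and r s :: real
    by (simp add: sum_distrib_left sum.distrib sum_subtractf distrib_left right_diff_distrib mult_ac)
  show ?thesis
    unfolding 1 2 3 4 5 * using cone_op_pointwise[OF t, of "snd p" "fst p" x \<mu> for p]
    by (simp only: prod.collapse)
qed

end

section \<open>Symmetry and orthogonality\<close>

text \<open>Exponents add; through this the integrability of monomials yields the integrability
  behind every inner product.\<close>

lemma cone_poly_mult:
  fixes f g :: "(real^'d) \<times> real \<Rightarrow> real"
  assumes "cone_poly m f" "cone_poly n g"
  shows "cone_poly (m + n) (\<lambda>z. f z * g z)"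
  unfolding cone_poly_def
proof (rule lincomb_trans_linear, fold cone_poly_def)
  show "lincomb cone_monomial {p. cone_deg p \<le> n} g"
    using assms(2) by (simp add: cone_poly_def)
next
  fix q :: "('d \<Rightarrow> nat) \<times> nat" assume q: "q \<in> {p. cone_deg p \<le> n}"
  have "cone_poly (m + n) (\<lambda>z. cone_monomial q z * f z)"
    unfolding cone_poly_def
  proof (rule lincomb_trans_linear, fold cone_poly_def)
    show "lincomb cone_monomial {p. cone_deg p \<le> m} f"
      using assms(1) by (simp add: cone_poly_def)
  next
    fix p :: "('d \<Rightarrow> nat) \<times> nat" assume p: "p \<in> {p. cone_deg p \<le> m}"
    show "cone_poly (m + n) (\<lambda>z. cone_monomial q z * cone_monomial p z)"
      unfolding cone_monomial_mult
      using p q by (intro cone_poly_monomial) (simp add: cone_deg_def sum.distrib)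
  qed
  then show "cone_poly (m + n) (\<lambda>z. f z * cone_monomial q z)"
    by (simp add: mult.commute)
qed

section \<open>Polynomials vanishing inside the cone\<close>

lemma cone_poly_continuous:
  assumes "cone_poly n f"
  shows "continuous_on UNIV f"
proof -
  from assms obtain c where "f = (\<lambda>z. \<Sum>p\<in>{p. cone_deg p \<le> n}. c p * cone_monomial p z)"
    by (auto simp: cone_poly_def lincomb_def)
  then show ?thesis
    by (simp add: cone_monomial_def case_prod_unfold) (intro continuous_intros)
qed

lemma cone_poly_line:
  assumes "cone_poly n f"
  shows "real_polynomial_function (\<lambda>s. f (s *\<^sub>R x, 1 + s * b))"
proof -
  from assms obtain c where f: "f = (\<lambda>z. \<Sum>p\<in>{p. cone_deg p \<le> n}. c p * cone_monomial p z)"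
    by (auto simp: cone_poly_def lincomb_def)
  have "real_polynomial_function (\<lambda>s::real. s)"
    by (rule real_polynomial_function.intros(1)) (rule bounded_linear_ident)
  then show ?thesis
    unfolding f cone_monomial_def
    by (auto intro!: real_polynomial_function_sum real_polynomial_function_prod finite_cone_deg
        real_polynomial_function_power real_polynomial_function_diff real_polynomial_function.intros(2-)
        simp: power_mult_distrib)
qed

lemma real_polynomial_function_eventually_0:
  fixes h :: "real \<Rightarrow> real"
  assumes h: "real_polynomial_function h" and ev: "eventually (\<lambda>s. h s = 0) (at 0)"
  shows "h s = 0"
proof -
  obtain a n where hs: "h = (\<lambda>x. \<Sum>i\<le>n. a i * x ^ i)"
    using real_polynomial_function_imp_sum[OF h] by blast
  from ev obtain d where d: "d > 0" "\<And>s. s \<noteq> 0 \<Longrightarrow> dist s 0 < d \<Longrightarrow> h s = 0"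
    unfolding eventually_at by auto
  then have "{0<..<d} \<subseteq> {s. h s = 0}" by auto
  then have "infinite {s. h s = 0}"
    using d(1) infinite_Ioo finite_subset by blast
  then have "\<forall>i\<le>n. a i = 0"
    using polyfun_finite_roots[of a n] unfolding hs by auto
  then show ?thesis by (simp add: hs)
qed

text \<open>On the line from the interior point (0, 1) through \<open>z\<close> the function is a
  polynomial in one variable that vanishes near the start s = 0, hence everywhere, in particular at
  s = 1.\<close>

lemma cone_poly_eq_0:
  assumes f: "cone_poly n f" and 0: "\<And>x t. norm x < \<bar>t\<bar> \<Longrightarrow> f (x, t) = 0"
  shows "f z = 0"
proof -
  obtain x t where z: "z = (x, t)" by (cases z)
  have "((\<lambda>s. norm (s *\<^sub>R x) - \<bar>1 + s * (t - 1)\<bar>) \<longlongrightarrow> norm (0 *\<^sub>R x) - \<bar>1 + 0 * (t - 1)\<bar>) (at 0)"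
    by (intro tendsto_intros)
  then have "eventually (\<lambda>s. norm (s *\<^sub>R x) - \<bar>1 + s * (t - 1)\<bar> < 0) (at 0)"
    by (rule order_tendstoD) simp
  then have "eventually (\<lambda>s. f (s *\<^sub>R x, 1 + s * (t - 1)) = 0) (at 0)"
    by (rule eventually_mono) (auto intro: 0)
  from real_polynomial_function_eventually_0[OF cone_poly_line[OF f] this, of 1]
  show ?thesis by (simp add: z)
qed

section \<open>The inner product for beta = 1/2 and the symmetry of the operator\<close>

context
  fixes \<mu> :: real and W :: "(real^'d) \<times> real \<Rightarrow> real"
  assumes \<mu>: "\<mu> > - 1/2"
  defines W: "W \<equiv> cone_weight (1/2) \<mu>"
begin

lemma cone_poly_integrable:
  assumes "cone_poly n f"
  shows "integrable lborel (\<lambda>z. indicator double_cone z * (f z * W z))"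
proof -
  from assms obtain c where f: "f = (\<lambda>z. \<Sum>p\<in>{p. cone_deg p \<le> n}. c p * cone_monomial p z)"
    by (auto simp: cone_poly_def lincomb_def)
  have "integrable lborel (\<lambda>z. \<Sum>p\<in>{p. cone_deg p \<le> n}.
      c p * (indicator double_cone z * (cone_monomial p z * W z)))"
    using has_bochner_integral_cone_monomial[OF \<mu>] unfolding W has_bochner_integral_iff
    by (intro Bochner_Integration.integrable_sum integrable_mult_right) blast
  then show ?thesis
    by (simp add: f sum_distrib_left sum_distrib_right mult_ac)
qed

lemma cone_inner_alt: "cone_inner W f g = (LINT z|lborel. indicator double_cone z * ((f z * g z) * W z))"
  by (simp add: cone_inner_def set_lebesgue_integral_def mult.assoc)

lemma cone_inner_commute: "cone_inner W f g = cone_inner W g f"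
  by (simp add: cone_inner_alt mult.commute)

lemma cone_inner_sum_left:
  assumes f: "\<And>p. p \<in> S \<Longrightarrow> cone_poly m (f p)" and g: "cone_poly n g"
  shows "cone_inner W (\<lambda>z. \<Sum>p\<in>S. c p * f p z) g = (\<Sum>p\<in>S. c p * cone_inner W (f p) g)"
proof -
  have "cone_inner W (\<lambda>z. \<Sum>p\<in>S. c p * f p z) g =
      (LINT z|lborel. (\<Sum>p\<in>S. c p * (indicator double_cone z * ((f p z * g z) * W z))))"
    by (simp add: cone_inner_alt sum_distrib_left sum_distrib_right mult_ac)
  also have "\<dots> = (\<Sum>p\<in>S. c p * cone_inner W (f p) g)"
    unfolding cone_inner_alt
    by (subst Bochner_Integration.integral_sum)
      (auto intro!: cone_poly_integrable cone_poly_mult f g)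
  finally show ?thesis .
qed

lemma cone_inner_add_left:
  assumes "cone_poly m f" "cone_poly m' f'" "cone_poly n g"
  shows "cone_inner W (\<lambda>z. f z + f' z) g = cone_inner W f g + cone_inner W f' g"
  using cone_poly_integrable[OF cone_poly_mult[OF assms(1,3)]] cone_poly_integrable[OF cone_poly_mult[OF assms(2,3)]]
  unfolding cone_inner_alt by (subst Bochner_Integration.integral_add[symmetric]) (auto simp: algebra_simps)

lemma cone_inner_cmult_left: "cone_inner W (\<lambda>z. r * f z) g = r * cone_inner W f g"
proof -
  have "(\<lambda>z. indicator double_cone z * ((r * f z * g z) * W z)) =
      (\<lambda>z. r * (indicator double_cone z * ((f z * g z) * W z)))"
    by (simp add: mult_ac)
  then show ?thesis by (simp add: cone_inner_alt)
qed

lemma cone_inner_monomial: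
  "cone_inner W (cone_monomial p) (cone_monomial q) =
    Gamma (\<mu> + 1/2 + real (snd p + snd q)) * (\<Prod>i\<in>UNIV. gauss_moment (fst p i + fst q i))"
  using has_bochner_integral_cone_monomial[OF \<mu>, of "(\<lambda>i. fst p i + fst q i, snd p + snd q)"]
  by (simp add: cone_inner_alt[unfolded W] cone_monomial_mult W has_bochner_integral_iff)

text \<open>What \<open>cone_op\<close> adds to multiplication by the eigenvalue
  \<open>- 2 * real (cone_deg p)\<close>.\<close>

definition cone_op_lower :: "('d \<Rightarrow> nat) \<times> nat \<Rightarrow> (real^'d) \<times> real \<Rightarrow> real"
  where "cone_op_lower p = (\<lambda>z.
    (\<Sum>i\<in>UNIV. (real (fst p i) * real (fst p i - 1)) * cone_monomial ((fst p)(i := fst p i - 2), snd p) z)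
    + (2 * real (snd p) * (2 * real (snd p) - 1 + 2 * \<mu>)) * cone_monomial (fst p, snd p - 1) z)"

lemma cone_op_split: "cone_op \<mu> p z = cone_op_lower p z + (- 2 * real (cone_deg p)) * cone_monomial p z"
  by (simp add: cone_op_def cone_op_lower_def)

text \<open>Every term lowers the degree by 2; where truncated subtraction would prevent this, the
  coefficient is 0.\<close>

lemma cone_op_lower_poly:
  fixes p :: "('d \<Rightarrow> nat) \<times> nat"
  shows "cone_poly (cone_deg p - 1) (cone_op_lower p)"
  unfolding cone_op_lower_def
proof (intro cone_poly_add cone_poly_sum)
  fix i
  show "cone_poly (cone_deg p - 1) (\<lambda>z. real (fst p i) * real (fst p i - 1) * cone_monomial ((fst p)(i := fst p i - 2), snd p) z)"
  proof (cases "fst p i \<ge> 2")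
    case True
    then show ?thesis
      using sum_fun_upd[of "fst p" i "fst p i - 2"]
      by (intro cone_poly_cmult cone_poly_monomial) (simp add: cone_deg_def)
  next
    case False
    then have "real (fst p i) * real (fst p i - 1) = 0" by (cases "fst p i") auto
    then show ?thesis by (simp only: mult_zero_left cone_poly_zero)
  qed
  show "cone_poly (cone_deg p - 1) (\<lambda>z. 2 * real (snd p) * (2 * real (snd p) - 1 + 2 * \<mu>) * cone_monomial (fst p, snd p - 1) z)"
  proof (cases "snd p")
    case 0
    then show ?thesis by (simp add: cone_poly_zero)
  next
    case (Suc j)
    then show ?thesis by (intro cone_poly_cmult cone_poly_monomial) (simp add: cone_deg_def)
  qed
qed

lemma cone_op_poly:
  fixes p :: "('d \<Rightarrow> nat) \<times> nat"
  shows "cone_poly (cone_deg p) (cone_op \<mu> p)"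
proof -
  have eq: "cone_op \<mu> p = (\<lambda>z. cone_op_lower p z + (- 2 * real (cone_deg p)) * cone_monomial p z)"
    by (simp only: cone_op_split[symmetric])
  show ?thesis
    unfolding eq by (intro cone_poly_add cone_poly_cmult cone_poly_monomial order_refl
        cone_poly_mono[OF cone_op_lower_poly]) simp
qed

text \<open>Gamma (y + 1) = y Gamma y at y = mu + 1/2 + (j + k - 1), positive because mu > - 1/2.
  The right-hand side is symmetric in \<open>j\<close> and \<open>k\<close>.\<close>

lemma Gamma_operator:
  "2 * real j * (2 * real j - 1 + 2 * \<mu>) * Gamma (\<mu> + 1/2 + real (j - 1 + k))
    - 4 * real j * Gamma (\<mu> + 1/2 + real (j + k)) =
    - 4 * real j * real k * Gamma (\<mu> + 1/2 + real (j + k - 1))"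
proof (cases j)
  case (Suc l)
  define y where "y = \<mu> + 1/2 + real (l + k)"
  have "y > 0" using \<mu> by (simp add: y_def add_pos_nonneg)
  then have "Gamma (y + 1) = y * Gamma y"
    by (intro Gamma_plus1) (auto simp: nonpos_Ints_def)
  moreover have "\<mu> + 1/2 + real (j + k) = y + 1" "\<mu> + 1/2 + real (j - 1 + k) = y"
      "\<mu> + 1/2 + real (j + k - 1) = y"
    by (simp_all add: y_def Suc)
  ultimately show ?thesis
    by (simp only:) (simp add: y_def Suc algebra_simps)
qed simp

text \<open>The right-hand side is minus the Dirichlet form in the coordinates (x, sigma), with
  weight 4 sigma on the sigma-derivatives. It comes from the two moment recurrences, one variable at
  a time, and its symmetry in \<open>p\<close> and \<open>q\<close> is visible.\<close>

lemma cone_inner_op_monomial: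
  "cone_inner W (cone_op \<mu> p) (cone_monomial q) =
    Gamma (\<mu> + 1/2 + real (snd p + snd q)) * (\<Sum>i\<in>UNIV.
      - real (fst p i) * real (fst q i) * gauss_moment (fst p i + fst q i - 2) *
      (\<Prod>l\<in>UNIV - {i}. gauss_moment (fst p l + fst q l)))
    - 4 * real (snd p) * real (snd q) * Gamma (\<mu> + 1/2 + real (snd p + snd q - 1)) *
      (\<Prod>i\<in>UNIV. gauss_moment (fst p i + fst q i))"
proof -
  obtain \<alpha> j where p: "p = (\<alpha>, j)" by (cases p)
  obtain \<beta> k where q: "q = (\<beta>, k)" by (cases q)
  let ?q = "cone_monomial q"
  let ?P = "\<Prod>i\<in>UNIV. gauss_moment (\<alpha> i + \<beta> i)"
  let ?R = "\<lambda>i. \<Prod>l\<in>UNIV - {i}. gauss_moment (\<alpha> l + \<beta> l)"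
  let ?G = "\<lambda>m. Gamma (\<mu> + 1/2 + real m)"
  have q_poly: "cone_poly (cone_deg q) ?q"
    by (simp add: cone_poly_monomial)
  have low: "cone_poly (cone_deg p) (cone_monomial (\<alpha>(i := \<alpha> i - 2), j))" for i
    using sum_fun_upd[of \<alpha> i "\<alpha> i - 2"] by (intro cone_poly_monomial) (simp add: cone_deg_def p)
  have P: "?P = gauss_moment (\<alpha> i + \<beta> i) * ?R i" for i
    by (simp add: prod.remove[of UNIV i])
  have inner_low: "cone_inner W (cone_monomial (\<alpha>(i := \<alpha> i - 2), j)) ?q =
      ?G (j + k) * (gauss_moment (\<alpha> i - 2 + \<beta> i) * ?R i)" for i
    by (simp add: cone_inner_monomial q prod.remove[of UNIV i])
  have "cone_inner W (cone_op \<mu> p) ?q = cone_inner W (cone_op_lower p) ?q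
      + (- 2 * real (cone_deg p)) * cone_inner W (cone_monomial p) ?q"
    unfolding cone_op_split[abs_def] cone_inner_cmult_left[symmetric]
    by (intro cone_inner_add_left[where m' = "cone_deg p", OF cone_op_lower_poly _ q_poly] cone_poly_cmult cone_poly_monomial order_refl)
  also have "cone_inner W (cone_op_lower p) ?q =
      (\<Sum>i\<in>UNIV. (real (\<alpha> i) * real (\<alpha> i - 1)) * cone_inner W (cone_monomial (\<alpha>(i := \<alpha> i - 2), j)) ?q)
      + (2 * real j * (2 * real j - 1 + 2 * \<mu>)) * cone_inner W (cone_monomial (\<alpha>, j - 1)) ?q"
  proof -
    have 1: "cone_poly (cone_deg p) (\<lambda>z. \<Sum>i\<in>UNIV.
        (real (\<alpha> i) * real (\<alpha> i - 1)) * cone_monomial (\<alpha>(i := \<alpha> i - 2), j) z)"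
      by (intro cone_poly_sum cone_poly_cmult low)
    have 2: "cone_poly (cone_deg p) (\<lambda>z.
        (2 * real j * (2 * real j - 1 + 2 * \<mu>)) * cone_monomial (\<alpha>, j - 1) z)"
      by (intro cone_poly_cmult cone_poly_monomial) (simp add: cone_deg_def p)
    show ?thesis
      unfolding cone_op_lower_def p fst_conv snd_conv cone_inner_add_left[OF 1 2 q_poly]
        cone_inner_sum_left[OF low q_poly] cone_inner_cmult_left ..
  qed
  also have "cone_inner W (cone_monomial (\<alpha>, j - 1)) ?q = ?G (j - 1 + k) * ?P"
    by (simp add: cone_inner_monomial q)
  also have "cone_inner W (cone_monomial p) ?q = ?G (j + k) * ?P"
    by (simp add: cone_inner_monomial p q)
  \<comment> \<open>The eigenvalue is distributed over the variables: 2 alpha_i goes to the Hermite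
    operator in x_i and 4 j to the Laguerre operator in sigma.\<close>
  also have "(\<Sum>i\<in>UNIV. (real (\<alpha> i) * real (\<alpha> i - 1)) * cone_inner W (cone_monomial (\<alpha>(i := \<alpha> i - 2), j)) ?q)
      + (2 * real j * (2 * real j - 1 + 2 * \<mu>)) * (?G (j - 1 + k) * ?P)
      + (- 2 * real (cone_deg p)) * (?G (j + k) * ?P) =
      ?G (j + k) * (\<Sum>i\<in>UNIV. (real (\<alpha> i) * real (\<alpha> i - 1) * gauss_moment (\<alpha> i - 2 + \<beta> i)
        - 2 * real (\<alpha> i) * gauss_moment (\<alpha> i + \<beta> i)) * ?R i)
      + (2 * real j * (2 * real j - 1 + 2 * \<mu>) * ?G (j - 1 + k) - 4 * real j * ?G (j + k)) * ?P"
  proof -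
    have "real (\<Sum>i\<in>UNIV. \<alpha> i) * ?P = (\<Sum>i\<in>UNIV. real (\<alpha> i) * gauss_moment (\<alpha> i + \<beta> i) * ?R i)"
      by (simp add: sum_distrib_right P[symmetric] mult.assoc)
    then have 1: "(\<Sum>i\<in>UNIV. (real (\<alpha> i) * real (\<alpha> i - 1) * gauss_moment (\<alpha> i - 2 + \<beta> i)
        - 2 * real (\<alpha> i) * gauss_moment (\<alpha> i + \<beta> i)) * ?R i) =
        (\<Sum>i\<in>UNIV. real (\<alpha> i) * real (\<alpha> i - 1) * (gauss_moment (\<alpha> i - 2 + \<beta> i) * ?R i))
        - 2 * (real (\<Sum>i\<in>UNIV. \<alpha> i) * ?P)"
      by (simp only: sum_distrib_left sum_subtractf[symmetric]) (simp add: algebra_simps)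
    have 2: "(\<Sum>i\<in>UNIV. (real (\<alpha> i) * real (\<alpha> i - 1)) * cone_inner W (cone_monomial (\<alpha>(i := \<alpha> i - 2), j)) ?q) =
        ?G (j + k) * (\<Sum>i\<in>UNIV. real (\<alpha> i) * real (\<alpha> i - 1) * (gauss_moment (\<alpha> i - 2 + \<beta> i) * ?R i))"
      by (simp only: inner_low sum_distrib_left mult_ac)
    show ?thesis
      unfolding 1 2 by (simp add: p cone_deg_def algebra_simps)
  qed
  finally show ?thesis
    unfolding gauss_moment_operator Gamma_operator by (simp add: p q)
qed

lemma cone_op_symmetric_monomial:
  "cone_inner W (cone_op \<mu> p) (cone_monomial q) = cone_inner W (cone_op \<mu> q) (cone_monomial p)"
  unfolding cone_inner_op_monomial by (simp add: add.commute mult_ac)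

text \<open>The integrand is nonnegative, so it vanishes almost everywhere. The weight is positive
  in the open cone, so the points there with nonzero value form an open null set, which is
  empty.\<close>

lemma cone_inner_definite:
  assumes f: "cone_poly n f" and 0: "cone_inner W f f = 0"
  shows "f z = 0"
proof (rule cone_poly_eq_0[OF f])
  fix x :: "real^'d" and t :: real
  assume xt: "norm x < \<bar>t\<bar>"
  let ?F = "\<lambda>z. indicator double_cone z * ((f z * f z) * W z)"
  have int: "integrable lborel ?F"
    by (rule cone_poly_integrable[OF cone_poly_mult[OF f f]])
  moreover have "0 \<le> ?F z" for z
    by (auto simp: W cone_weight_def split: prod.split)
  ultimately have "AE z in lborel. ?F z = 0"
    using 0 integral_nonneg_eq_0_iff_AE[OF int] by (simp add: cone_inner_alt)
  then obtain N where N: "{z. ?F z \<noteq> 0} \<subseteq> N" "N \<in> null_sets lborel"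
    by (auto elim!: AE_E simp: null_sets_def)
  define U where "U = {z. norm (fst z) < \<bar>snd z\<bar>} \<inter> {z. f z \<noteq> 0}"
  have "open {z. f z \<noteq> 0}"
    using cone_poly_continuous[OF f] by (intro open_Collect_neq continuous_on_const)
  then have "open U"
    unfolding U_def by (intro open_Int open_Collect_less continuous_intros)
  moreover have "U \<subseteq> {z. ?F z \<noteq> 0}"
  proof
    fix z assume z: "z \<in> U"
    obtain x t where [simp]: "z = (x, t)" by (cases z)
    from z have "norm x < \<bar>t\<bar>" "f z \<noteq> 0" by (auto simp: U_def)
    moreover from this have "(norm x)\<^sup>2 < t\<^sup>2"
      using power_strict_mono[of "norm x" "\<bar>t\<bar>" 2] by simp
    ultimately show "z \<in> {z. ?F z \<noteq> 0}"
      by (auto simp: W cone_weight_def double_cone_def)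
  qed
  ultimately have "negligible U"
    using N by (meson negligible_iff_null_sets negligible_subset null_sets_completionI order_trans)
  with \<open>open U\<close> have "U = {}"
    using open_not_negligible by blast
  then have "(x, t) \<notin> U" by simp
  with xt show "f (x, t) = 0" by (simp add: U_def)
qed

text \<open>Bilinear extension from monomials. The operator acts on coefficient families, which
  makes it linear by construction.\<close>

lemma cone_op_symmetric:
  fixes m n :: nat and b c :: "('d \<Rightarrow> nat) \<times> nat \<Rightarrow> real"
  defines "S \<equiv> {p. cone_deg p \<le> n}" and "T \<equiv> {p. cone_deg p \<le> m}"
  shows "cone_inner W (\<lambda>z. \<Sum>p\<in>S. c p * cone_op \<mu> p z) (\<lambda>z. \<Sum>q\<in>T. b q * cone_monomial q z) =
    cone_inner W (\<lambda>z. \<Sum>q\<in>T. b q * cone_op \<mu> q z) (\<lambda>z. \<Sum>p\<in>S. c p * cone_monomial p z)"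
proof -
  have 1: "cone_inner W (\<lambda>z. \<Sum>p\<in>{p. cone_deg p \<le> n}. c p * cone_op \<mu> p z)
      (\<lambda>z. \<Sum>q\<in>{p. cone_deg p \<le> m}. b q * cone_monomial q z) =
    (\<Sum>p\<in>{p. cone_deg p \<le> n}. \<Sum>q\<in>{p. cone_deg p \<le> m}.
      c p * (b q * cone_inner W (cone_op \<mu> p) (cone_monomial q)))" for m n and b c :: "('d \<Rightarrow> nat) \<times> nat \<Rightarrow> real"
  proof -
    have op: "cone_poly n (cone_op \<mu> p)" if "p \<in> {p. cone_deg p \<le> n}" for p :: "('d \<Rightarrow> nat) \<times> nat"
      using that cone_poly_mono[OF cone_op_poly] by simp
    have mon: "cone_poly m (cone_monomial q)" if "q \<in> {p. cone_deg p \<le> m}" for q :: "('d \<Rightarrow> nat) \<times> nat"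
      using that by (simp add: cone_poly_monomial)
    have "cone_inner W (cone_op \<mu> p) (\<lambda>z. \<Sum>q\<in>{p. cone_deg p \<le> m}. b q * cone_monomial q z) =
        (\<Sum>q\<in>{p. cone_deg p \<le> m}. b q * cone_inner W (cone_op \<mu> p) (cone_monomial q))"
      if "p \<in> {p. cone_deg p \<le> n}" for p
      unfolding cone_inner_commute[of "cone_op \<mu> p"] by (rule cone_inner_sum_left[OF mon op[OF that]])
    then show ?thesis
      by (subst cone_inner_sum_left[OF op]) (auto simp: sum_distrib_left intro!: cone_poly_sum cone_poly_cmult mon)
  qed
  show ?thesis
    unfolding S_def T_def 1 by (subst sum.swap) (simp only: cone_op_symmetric_monomial mult.left_commute)
qed

lemma V_even_cone_op:
  assumes u: "u \<in> V_even n W"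
  shows "\<exists>c. u = (\<lambda>z. \<Sum>p\<in>{p. cone_deg p \<le> n}. c p * cone_monomial p z) \<and>
    (\<forall>z. (\<Sum>p\<in>{p. cone_deg p \<le> n}. c p * cone_op \<mu> p z) = - 2 * real n * u z)"
proof -
  let ?S = "\<lambda>n. {p :: ('d \<Rightarrow> nat) \<times> nat. cone_deg p \<le> n}"
  from u have u_poly: "cone_poly n u"
    by (intro cone_poly_even) (auto simp: V_even_def)
  then obtain c where c: "u = (\<lambda>z. \<Sum>p\<in>?S n. c p * cone_monomial p z)"
    by (auto simp: cone_poly_def lincomb_def)
  define Lu where "Lu = (\<lambda>z. \<Sum>p\<in>?S n. c p * cone_op \<mu> p z)"
  define r where "r = (\<lambda>z. Lu z + 2 * real n * u z)"
  \<comment> \<open>The factor \<open>real n - real (cone_deg p)\<close> removes the monomials of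
    top degree \<open>n\<close>, so \<open>r\<close> has degree at most
    \<open>n - 1\<close>.\<close>
  have r_alt: "r = (\<lambda>z. \<Sum>p\<in>?S n. c p * (cone_op_lower p z + 2 * (real n - real (cone_deg p)) * cone_monomial p z))"
    by (auto simp: r_def Lu_def c cone_op_split sum_distrib_left sum.distrib[symmetric] fun_eq_iff algebra_simps
        intro!: sum.cong)
  have "r z = 0" for z
  proof (cases "n = 0")
    \<comment> \<open>There is no orthogonality to use in degree 0; the operator simply annihilates
      constants.\<close>
    case True
    have "cone_op_lower p z = 0" if "cone_deg p = 0" for p
      using that by (simp add: cone_op_lower_def cone_deg_def)
    with True show ?thesis by (simp add: r_alt)
  next
    case False
    have r_poly: "cone_poly (n - 1) r"
      unfolding r_alt
    proof (rule cone_poly_sum, rule cone_poly_cmult, rule cone_poly_add)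
      fix p :: "('d \<Rightarrow> nat) \<times> nat" assume p: "p \<in> ?S n"
      then show "cone_poly (n - 1) (cone_op_lower p)"
        by (intro cone_poly_mono[OF cone_op_lower_poly]) (simp add: diff_le_mono)
      show "cone_poly (n - 1) (\<lambda>z. 2 * (real n - real (cone_deg p)) * cone_monomial p z)"
      proof (cases "cone_deg p = n")
        case True
        then show ?thesis by (simp add: cone_poly_zero)
      next
        case False
        with p show ?thesis by (intro cone_poly_cmult cone_poly_monomial) simp
      qed
    qed
    then obtain b where b: "r = (\<lambda>z. \<Sum>q\<in>?S (n - 1). b q * cone_monomial q z)"
      by (auto simp: cone_poly_def lincomb_def)
    define Lr where "Lr = (\<lambda>z. \<Sum>q\<in>?S (n - 1). b q * cone_op \<mu> q z)"
    have Lr_poly: "cone_poly (n - 1) Lr"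
      unfolding Lr_def by (intro cone_poly_sum cone_poly_cmult) (simp add: cone_poly_mono[OF cone_op_poly])
    have Lu_poly: "cone_poly n Lu"
      unfolding Lu_def by (intro cone_poly_sum cone_poly_cmult) (simp add: cone_poly_mono[OF cone_op_poly])
    have orth: "cone_inner W u q = 0" if "cone_poly (n - 1) q" for q
    proof -
      have "n - 1 < n" using False by simp
      then show ?thesis
        using u cone_poly_poly_deg_le[OF that] cone_poly_even_in_t[OF that]
        unfolding V_even_def by blast
    qed
    \<comment> \<open>Symmetry moves the operator onto \<open>r\<close>; it does not raise degrees,
      so \<open>Lr\<close> is again orthogonal to \<open>u\<close>.\<close>
    have "cone_inner W Lu r = cone_inner W Lr u"
      unfolding Lu_def Lr_def by (subst b, subst c, rule cone_op_symmetric)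
    also have "\<dots> = 0"
      unfolding cone_inner_commute[of Lr] by (rule orth[OF Lr_poly])
    finally have "cone_inner W Lu r = 0" .
    moreover have "cone_inner W r r = cone_inner W Lu r + cone_inner W (\<lambda>z. 2 * real n * u z) r"
      by (subst (1) r_def, rule cone_inner_add_left[OF Lu_poly _ r_poly], rule cone_poly_cmult, rule u_poly)
    moreover have "cone_inner W (\<lambda>z. 2 * real n * u z) r = 0"
      by (simp add: cone_inner_cmult_left orth[OF r_poly])
    ultimately show ?thesis
      by (intro cone_inner_definite[OF r_poly]) simp
  qed
  then have "Lu z = - 2 * real n * u z" for z
    by (simp add: r_def add_eq_0_iff)
  then show ?thesis
    using c by (auto simp: Lu_def)
qed

lemma V_even_equation:
  assumes u: "u \<in> V_even n W" and t: "t \<noteq> 0"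
  shows "D_t (D_t u) (x, t) + Laplace_x u (x, t) + 2 / t * Euler_x (D_t u) (x, t)
      - 2 * (t * D_t u (x, t) + Euler_x u (x, t)) + (2 * \<mu> + real CARD('d)) / t * D_t u (x, t)
    = - 2 * real n * u (x, t)"
proof -
  obtain c where "u = (\<lambda>z. \<Sum>p\<in>{p. cone_deg p \<le> n}. c p * cone_monomial p z)"
    and "\<And>z. (\<Sum>p\<in>{p. cone_deg p \<le> n}. c p * cone_op \<mu> p z) = - 2 * real n * u z"
    using V_even_cone_op[OF u] by blast
  with cone_sum_operator[OF this(1) t] show ?thesis by simp
qed

end

section \<open>Reduction of the odd case to the even one\<close>

text \<open>Conjugation by t turns d/dt - 1/t into d/dt. The second derivative of t v has the extra
  term 2 dv/dt, which accounts for the 2 missing from the last coefficient, and the Euler term in t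
  produces the extra - 2 v.\<close>

lemma cone_poly_odd_operator:
  fixes v :: "(real^'d) \<times> real \<Rightarrow> real" and \<mu> :: real
  assumes v: "cone_poly n v" and t: "t \<noteq> 0"
  defines "u \<equiv> \<lambda>(x, t). t * v (x, t)"
  shows "D_t (D_t u) (x, t) + Laplace_x u (x, t) + 2 / t * Euler_x (D_t_minus u) (x, t)
      - 2 * (t * D_t u (x, t) + Euler_x u (x, t))
      + (2 * \<mu> + real CARD('d) - 2) / t * D_t_minus u (x, t)
    = t * (D_t (D_t v) (x, t) + Laplace_x v (x, t) + 2 / t * Euler_x (D_t v) (x, t)
      - 2 * (t * D_t v (x, t) + Euler_x v (x, t)) + (2 * \<mu> + real CARD('d)) / t * D_t v (x, t)
      - 2 * v (x, t))"
proof -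
  obtain c where c: "v = (\<lambda>z. \<Sum>p\<in>{p. cone_deg p \<le> n}. c p * cone_monomial p z)"
    using v by (auto simp: cone_poly_def lincomb_def)
  note diff = cone_sum_differentiable[OF c, THEN field_differentiable_derivI]
  have d_t: "((\<lambda>s. v (x, s)) has_field_derivative D_t v (x, t)) (at t)" for x t
    using diff(1) by (simp add: D_t_def)
  have d_tt: "((\<lambda>s. D_t v (x, s)) has_field_derivative D_t (D_t v) (x, t)) (at t)" for x t
    using diff(2) by (simp add: D_t_def[of "D_t v"])
  have d_x: "((\<lambda>s. v (x + s *\<^sub>R axis i 1, t)) has_field_derivative D_x i v (x, t)) (at 0)" for x t i
    using diff(3) by (simp add: D_x_def)
  have d_xt: "((\<lambda>s. D_t v (x + s *\<^sub>R axis i 1, t)) has_field_derivative D_x i (D_t v) (x, t)) (at 0)" for x t i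
    using diff(4) by (simp add: D_x_def)
  have d_xx: "((\<lambda>s. D_x i v (x + s *\<^sub>R axis i 1, t)) has_field_derivative D_x i (D_x i v) (x, t)) (at 0)" for x t i
    using diff(5) by (simp add: D_x_def[of i "D_x i v"])
  have Dt: "D_t u = (\<lambda>(x, t). v (x, t) + t * D_t v (x, t))"
    unfolding u_def by (auto simp: fun_eq_iff intro!: D_t_eq derivative_eq_intros d_t)
  have Dtt: "D_t (D_t u) (x, t) = 2 * D_t v (x, t) + t * D_t (D_t v) (x, t)"
    unfolding Dt by (rule D_t_eq) (auto intro!: derivative_eq_intros d_t d_tt)
  have Dx: "D_x i u = (\<lambda>(x, t). t * D_x i v (x, t))" for i
    unfolding u_def by (auto simp: fun_eq_iff intro!: D_x_eq derivative_eq_intros d_x)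
  have Dxx: "D_x i (D_x i u) (x, t) = t * D_x i (D_x i v) (x, t)" for i
    unfolding Dx by (rule D_x_eq) (auto intro!: derivative_eq_intros d_xx)
  \<comment> \<open>Stated for every \<open>y\<close> at the fixed nonzero \<open>t\<close>, since
    it is differentiated in x next.\<close>
  have Dm: "D_t_minus u (y, t) = t * D_t v (y, t)" for y
    using t by (simp add: D_t_minus_def Dt) (simp add: u_def)
  have Dxm: "D_x i (D_t_minus u) (x, t) = t * D_x i (D_t v) (x, t)" for i
    by (rule D_x_eq) (auto simp: Dm intro!: derivative_eq_intros d_xt)
  have "Euler_x (D_t_minus u) (x, t) = t * Euler_x (D_t v) (x, t)"
    by (simp add: Euler_x_def Dxm sum_distrib_left mult_ac)
  moreover have "Euler_x u (x, t) = t * Euler_x v (x, t)"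
    by (simp add: Euler_x_def Dx sum_distrib_left mult_ac)
  moreover have "Laplace_x u (x, t) = t * Laplace_x v (x, t)"
    by (simp add: Laplace_x_def Dxx sum_distrib_left)
  moreover have "D_t u (x, t) = v (x, t) + t * D_t v (x, t)"
    by (simp add: Dt)
  ultimately show ?thesis
    using t by (simp add: Dtt Dm field_simps)
qed

text \<open>Pairing t v with t q contributes t^2, and t^2 |t|^(-1) = |t| exchanges the weight with
  beta = - 1/2 for the one with beta = 1/2. Thus orthogonality passes from \<open>u\<close> to
  \<open>v\<close>, with all degrees lowered by 1.\<close>

lemma V_odd_factor:
  fixes u :: "(real^'d) \<times> real \<Rightarrow> real"
  assumes u: "u \<in> V_odd n (cone_weight (- 1/2) \<mu>)"
  obtains v where "v \<in> V_even (n - 1) (cone_weight (1/2) \<mu>)" "n = 0 \<longrightarrow> v = (\<lambda>_. 0)"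
    "u = (\<lambda>(x, t). t * v (x, t))"
proof -
  obtain v where v: "cone_poly (n - 1) v" "n = 0 \<longrightarrow> v = (\<lambda>_. 0)" and uv: "u = (\<lambda>(x, t). t * v (x, t))"
    using u cone_poly_odd[of u n] by (auto simp: V_odd_def)
  have "cone_inner (cone_weight (1/2) \<mu>) v q = 0"
    if m: "m < n - 1" and q: "q \<in> poly_deg_le m" "even_in_t q" for m q
  proof -
    have "(\<lambda>(x, t). t * q (x, t)) \<in> poly_deg_le (m + 1)"
      using q(1) by (rule poly_deg_le_mult_t)
    moreover have "odd_in_t (\<lambda>(x, t). t * q (x, t))"
      using q(2) by (simp add: odd_in_t_def even_in_t_def)
    ultimately have "cone_inner (cone_weight (- 1/2) \<mu>) u (\<lambda>(x, t). t * q (x, t)) = 0"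
      using u m unfolding V_odd_def less_diff_conv by blast
    moreover have "u z * (case z of (x, t) \<Rightarrow> t * q (x, t)) * cone_weight (- 1/2) \<mu> z =
        v z * q z * cone_weight (1/2) \<mu> z" for z
    proof (cases z)
      case (Pair x t)
      let ?e = "exp (- t\<^sup>2) * (t\<^sup>2 - (norm x)\<^sup>2) powr (\<mu> - 1/2)"
      \<comment> \<open>At \<open>t = 0\<close> both sides are 0 by the convention for
        \<open>powr\<close>.\<close>
      have "t * t * \<bar>t\<bar> powr (2 * (- 1/2)) = \<bar>t\<bar> powr (2 * (1/2))"
        by (cases "t = 0") (simp_all add: powr_minus field_simps)
      then have "v (x, t) * q (x, t) * (t * t * \<bar>t\<bar> powr (2 * (- 1/2))) * ?e =
          v (x, t) * q (x, t) * \<bar>t\<bar> powr (2 * (1/2)) * ?e"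
        by (simp only:)
      then show ?thesis
        by (simp only: Pair uv cone_weight_def case_prod_conv mult_ac)
    qed
    ultimately show ?thesis
      by (simp only: cone_inner_def)
  qed
  with v have "v \<in> V_even (n - 1) (cone_weight (1/2) \<mu>)"
    by (auto simp: V_even_def cone_poly_poly_deg_le cone_poly_even_in_t)
  with v(2) uv that show thesis by blast
qed

theorem theorem7p10:
  fixes \<mu> :: real
  assumes "\<mu> > - 1/2"
  shows "(\<forall>n. \<forall>u \<in> V_even n (cone_weight (1/2) \<mu> :: (real^'d) \<times> real \<Rightarrow> real).
      \<forall>x t. t \<noteq> 0 \<longrightarrow>
        D_t (D_t u) (x, t) + Laplace_x u (x, t)
        + 2 / t * Euler_x (D_t u) (x, t)
        - 2 * (t * D_t u (x, t) + Euler_x u (x, t))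
        + (2 * \<mu> + real CARD('d)) / t * D_t u (x, t)
        = - 2 * real n * u (x, t))
    \<and> (\<forall>n. \<forall>u \<in> V_odd n (cone_weight (- 1/2) \<mu> :: (real^'d) \<times> real \<Rightarrow> real).
      \<forall>x t. t \<noteq> 0 \<longrightarrow>
        D_t (D_t u) (x, t) + Laplace_x u (x, t)
        + 2 / t * Euler_x (D_t_minus u) (x, t)
        - 2 * (t * D_t u (x, t) + Euler_x u (x, t))
        + (2 * \<mu> + real CARD('d) - 2) / t * D_t_minus u (x, t)
        = - 2 * real n * u (x, t))"
proof (intro conjI allI ballI impI)
  fix n u and t :: real and x :: "real^'d"
  assume "u \<in> V_even n (cone_weight (1/2) \<mu> :: (real^'d) \<times> real \<Rightarrow> real)" "t \<noteq> 0"
  then show "D_t (D_t u) (x, t) + Laplace_x u (x, t) + 2 / t * Euler_x (D_t u) (x, t)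
        - 2 * (t * D_t u (x, t) + Euler_x u (x, t))
        + (2 * \<mu> + real CARD('d)) / t * D_t u (x, t) = - 2 * real n * u (x, t)"
    by (rule V_even_equation[OF assms])
next
  fix n u and t :: real and x :: "real^'d"
  assume t: "t \<noteq> 0"
  assume "u \<in> V_odd n (cone_weight (- 1/2) \<mu> :: (real^'d) \<times> real \<Rightarrow> real)"
  then obtain v where v: "v \<in> V_even (n - 1) (cone_weight (1/2) \<mu>)"
    and n: "n = 0 \<longrightarrow> v = (\<lambda>_. 0)" and u: "u = (\<lambda>(x, t). t * v (x, t))"
    by (rule V_odd_factor)
  from v have v_poly: "cone_poly (n - 1) v"
    by (intro cone_poly_even) (auto simp: V_even_def)
  \<comment> \<open>The even equation gives - 2 (n - 1), and the extra - 2 v makes it - 2 n. For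
    \<open>n = 0\<close>, where \<open>n - 1\<close> is truncated, \<open>v\<close> is zero.\<close>
  show "D_t (D_t u) (x, t) + Laplace_x u (x, t) + 2 / t * Euler_x (D_t_minus u) (x, t)
        - 2 * (t * D_t u (x, t) + Euler_x u (x, t))
        + (2 * \<mu> + real CARD('d) - 2) / t * D_t_minus u (x, t) = - 2 * real n * u (x, t)"
    unfolding u cone_poly_odd_operator[OF v_poly t] V_even_equation[OF assms v t]
    using n by (cases n) (auto simp: algebra_simps)
qed

end
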